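(* For every real number $\lambda>1$ there exists a Banach space that is $(\lambda^+)$-injective but not $\lambda$-injective.
   Context: Banach spaces are over a fixed scalar field $\mathbb K\in\{\mathbb R,\mathbb C\}$ (the statement is for either choice). Let $\lambda\ge 1$. A Banach space $X$ is $\lambda$-injective if for every Banach space $Z$, every subspace $E\subset Z$ and every bounded linear operator $T\colon E\to X$ there is a bounded linear extension $\widetilde T\colon Z\to X$ of $T$ with $\|\widetilde T\|\le\lambda\|T\|$. A Banach space $X$ is $(\lambda^+)$-injective if it is $(\lambda+\varepsilon)$-injective for every $\varepsilon>0$. *)

theory Defs
  imports "HOL-Algebra.Module" "HOL-Analysis.Analysis"
begin

definition scalar_field :: "'k::real_normed_field ring" where
  "scalar_field = \<lparr>carrier = UNIV, monoid.mult = (*), one = 1, ring.zero = 0, add = (+)\<rparr>"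

lemma scalar_field_simps [simp]:
  "carrier scalar_field = UNIV" "x \<otimes>\<^bsub>scalar_field\<^esub> y = x * y" "\<one>\<^bsub>scalar_field\<^esub> = 1"
  "\<zero>\<^bsub>scalar_field\<^esub> = 0" "x \<oplus>\<^bsub>scalar_field\<^esub> y = x + y"
  by (simp_all add: scalar_field_def)

lemma cring_scalar_field: "cring (scalar_field :: 'k::real_normed_field ring)"
proof (rule cringI)
  show "abelian_group (scalar_field :: 'k ring)"
  proof (rule abelian_groupI)
    show "\<exists>y\<in>carrier (scalar_field :: 'k ring). y \<oplus>\<^bsub>scalar_field\<^esub> x = \<zero>\<^bsub>scalar_field\<^esub>" for x :: 'k
      by (rule bexI[of _ "-x"]) auto
  qed (auto simp: algebra_simps)
  show "comm_monoid (scalar_field :: 'k ring)"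
    by (rule comm_monoidI) (auto simp: algebra_simps)
qed (auto simp: algebra_simps)

lemma a_inv_scalar_field [simp]: "\<ominus>\<^bsub>scalar_field\<^esub> x = - (x :: 'k::real_normed_field)"
proof -
  interpret cring "scalar_field :: 'k ring" by (rule cring_scalar_field)
  show ?thesis by (rule minus_equality) auto
qed

text \<open>
  Banach spaces are carrier-based, so that one formula can quantify over all of them.
  The fields \<open>mult\<close> and \<open>one\<close> that \<^typ>\<open>('k, 'a) module\<close> inherits from rings are never used.
\<close>

record ('k, 'a) normed_module = "('k, 'a) module" +
  vnorm :: "'a \<Rightarrow> real"

locale normed_vector_space = Module.module scalar_field X
  for X :: "('k::real_normed_field, 'a) normed_module" (structure) +
  assumes vnorm_eq_0_iff: "x \<in> carrier X \<Longrightarrow> vnorm X x = 0 \<longleftrightarrow> x = \<zero>"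
    and vnorm_triangle: "\<lbrakk>x \<in> carrier X; y \<in> carrier X\<rbrakk> \<Longrightarrow> vnorm X (x \<oplus> y) \<le> vnorm X x + vnorm X y"
    and vnorm_smult: "x \<in> carrier X \<Longrightarrow> vnorm X (c \<odot> x) = norm c * vnorm X x"

locale banach_space = normed_vector_space +
  assumes complete:
    "\<lbrakk>\<And>n. s n \<in> carrier X;
      \<forall>e>0. \<exists>N::nat. \<forall>m\<ge>N. \<forall>n\<ge>N. vnorm X (s m \<ominus> s n) < e\<rbrakk>
     \<Longrightarrow> \<exists>l\<in>carrier X. (\<lambda>n. vnorm X (s n \<ominus> l)) \<longlonglongrightarrow> 0"

definition bounded_operator ::
  "('k::real_normed_field, 'a) normed_module \<Rightarrow> ('k, 'b) normed_module \<Rightarrow> ('a \<Rightarrow> 'b) \<Rightarrow> bool" where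
  "bounded_operator A B T \<longleftrightarrow>
     T \<in> carrier A \<rightarrow> carrier B \<and>
     (\<forall>x\<in>carrier A. \<forall>y\<in>carrier A. T (x \<oplus>\<^bsub>A\<^esub> y) = T x \<oplus>\<^bsub>B\<^esub> T y) \<and>
     (\<forall>c. \<forall>x\<in>carrier A. T (c \<odot>\<^bsub>A\<^esub> x) = c \<odot>\<^bsub>B\<^esub> T x) \<and>
     (\<exists>C. \<forall>x\<in>carrier A. vnorm B (T x) \<le> C * vnorm A x)"

text \<open>As in \<^const>\<open>onorm\<close>, the quotient at \<open>0\<close> is \<open>0 / 0 = 0\<close>.\<close>

definition op_norm ::
  "('k::real_normed_field, 'a) normed_module \<Rightarrow> ('k, 'b) normed_module \<Rightarrow> ('a \<Rightarrow> 'b) \<Rightarrow> real" where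
  "op_norm A B T = (SUP x\<in>carrier A. vnorm B (T x) / vnorm A x)"

text \<open>
  \<open>injective_wrt TYPE('z) lam X\<close>: the extension property holds for all Banach spaces \<open>Z\<close> whose
  underlying set is a subset of the type \<open>'z\<close>, and all linear, not necessarily closed,
  subspaces \<open>E\<close> of \<open>Z\<close>.
\<close>

definition injective_wrt ::
  "'z itself \<Rightarrow> real \<Rightarrow> ('k::real_normed_field, 'x) normed_module \<Rightarrow> bool" where
  "injective_wrt _ lam X \<longleftrightarrow>
     (\<forall>(Z :: ('k, 'z) normed_module) E T.
        banach_space Z \<longrightarrow> submodule E scalar_field Z \<longrightarrow>
        bounded_operator (Z\<lparr>carrier := E\<rparr>) X T \<longrightarrow>
        (\<exists>T'. bounded_operator Z X T' \<and> (\<forall>x\<in>E. T' x = T x) \<and>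
              op_norm Z X T' \<le> lam * op_norm (Z\<lparr>carrier := E\<rparr>) X T))"

text \<open>
  A formula of HOL cannot quantify over types, so the test spaces \<open>Z\<close> have to live in a fixed
  type.  The type \<open>'x \<Rightarrow> 'k\<close> loses nothing: it contains the space of bounded scalar functions on
  the underlying set of \<open>X\<close>, and the theorems \<open>injective_imp_injective_wrt_real\<close> and
  \<open>injective_imp_injective_wrt_complex\<close> below show that \<open>injective lam X\<close> yields the extension
  property for Banach spaces \<open>Z\<close> over an arbitrary type.
\<close>

definition injective :: "real \<Rightarrow> ('k::real_normed_field, 'x) normed_module \<Rightarrow> bool" where
  "injective lam X \<longleftrightarrow> injective_wrt TYPE('x \<Rightarrow> 'k) lam X"

definition plus_injective :: "real \<Rightarrow> ('k::real_normed_field, 'x) normed_module \<Rightarrow> bool" where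
  "plus_injective lam X \<longleftrightarrow> (\<forall>\<epsilon>>0. injective (lam + \<epsilon>) X)"

text \<open>
  Why one type of test spaces suffices: \<open>X\<close> embeds isometrically into the space of bounded
  functions on its underlying set by Hahn--Banach, extending the inverse of the embedding gives a
  map \<open>P\<close> of norm at most \<open>lam\<close> that is a left inverse of the embedding, and operators into bounded
  functions extend coordinatewise from \<open>E\<close> to \<open>Z\<close> without increasing the norm.
\<close>

context normed_vector_space
begin

lemma vnorm_zero [simp]: "vnorm X \<zero> = 0"
  using vnorm_eq_0_iff by blast

lemma smult_neg_one: "x \<in> carrier X \<Longrightarrow> (-1) \<odot> x = \<ominus> x"
  using smult_l_minus[of 1 x] smult_one[of x] by simp

lemma vnorm_neg: "x \<in> carrier X \<Longrightarrow> vnorm X (\<ominus> x) = vnorm X x"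
  using vnorm_smult[of x "-1"] smult_neg_one[of x] by simp

lemma vnorm_nonneg: 
  assumes "x \<in> carrier X" shows "0 \<le> vnorm X x"
  using vnorm_triangle[of x "\<ominus> x"] vnorm_neg[of x] assms by (simp add: r_neg)

end

lemma normed_vector_space_submodule:
  assumes "normed_vector_space Z" "submodule E scalar_field Z"
  shows "normed_vector_space (Z\<lparr>carrier := E\<rparr>)"
proof -
  interpret normed_vector_space Z by fact
  have mod: "Module.module scalar_field (Z\<lparr>carrier := E\<rparr>)"
    by (rule submodule.submodule_is_module[OF assms(2) module_axioms])
  have sub: "E \<subseteq> carrier Z" using submoduleE(1)[OF assms(2)] .
  show ?thesis
    by (rule normed_vector_space.intro[OF mod], unfold_locales)
       (use sub vnorm_eq_0_iff vnorm_smult in \<open>auto intro!: vnorm_triangle\<close>)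
qed

lemma op_norm_bdd:
  assumes A: "normed_vector_space A" and T: "bounded_operator A B T"
  shows "bdd_above ((\<lambda>x. vnorm B (T x) / vnorm A x) ` carrier A)"
proof -
  interpret A: normed_vector_space A by fact
  from T obtain C where C: "\<And>x. x \<in> carrier A \<Longrightarrow> vnorm B (T x) \<le> C * vnorm A x"
    unfolding bounded_operator_def by blast
  show ?thesis
  proof (rule bdd_aboveI2)
    fix y assume y: "y \<in> carrier A"
    show "vnorm B (T y) / vnorm A y \<le> \<bar>C\<bar>"
    proof (cases "vnorm A y = 0")
      case False
      with A.vnorm_nonneg[OF y] have "vnorm A y > 0" by simp
      moreover have "C * vnorm A y \<le> \<bar>C\<bar> * vnorm A y"
        using A.vnorm_nonneg[OF y] by (intro mult_right_mono) auto
      then have "vnorm B (T y) \<le> \<bar>C\<bar> * vnorm A y" using C[OF y] by (rule order_trans[rotated])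
      ultimately show ?thesis by (simp add: pos_divide_le_eq)
    qed simp
  qed
qed

lemma bounded_operator_bound:
  assumes A: "normed_vector_space A" and T: "bounded_operator A B T" and x: "x \<in> carrier A"
  shows "vnorm B (T x) \<le> op_norm A B T * vnorm A x"
proof -
  interpret A: normed_vector_space A by fact
  from T obtain C where C: "\<And>x. x \<in> carrier A \<Longrightarrow> vnorm B (T x) \<le> C * vnorm A x"
    unfolding bounded_operator_def by blast
  show ?thesis
  proof (cases "vnorm A x = 0")
    case True
    then show ?thesis using C[OF x] by simp
  next
    case False
    with A.vnorm_nonneg[OF x] have pos: "vnorm A x > 0" by simp
    have "vnorm B (T x) / vnorm A x \<le> op_norm A B T"
      unfolding op_norm_def by (rule cSUP_upper[OF x op_norm_bdd[OF A T]])
    then show ?thesis using pos by (simp add: pos_divide_le_eq)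
  qed
qed

lemma op_norm_le:
  assumes A: "normed_vector_space A" and "0 \<le> C"
    and C: "\<And>x. x \<in> carrier A \<Longrightarrow> vnorm B (T x) \<le> C * vnorm A x"
  shows "op_norm A B T \<le> C"
proof -
  interpret A: normed_vector_space A by fact
  show ?thesis unfolding op_norm_def
  proof (rule cSUP_least)
    show "carrier A \<noteq> {}" using A.zero_closed by blast
    fix x assume x: "x \<in> carrier A"
    show "vnorm B (T x) / vnorm A x \<le> C"
      using C[OF x] A.vnorm_nonneg[OF x] \<open>0 \<le> C\<close> by (cases "vnorm A x = 0") (auto simp: divide_simps)
  qed
qed

lemma op_norm_nonneg:
  assumes A: "normed_vector_space A" and T: "bounded_operator A B T"
  shows "0 \<le> op_norm A B T"
proof -
  interpret A: normed_vector_space A by fact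
  have "vnorm B (T \<zero>\<^bsub>A\<^esub>) / vnorm A \<zero>\<^bsub>A\<^esub> \<le> op_norm A B T"
    unfolding op_norm_def by (rule cSUP_upper[OF A.zero_closed op_norm_bdd[OF A T]])
  then show ?thesis by simp
qed

lemma hahn_banach_sublinear:
  fixes Z :: "(real, 'z, 'm) module_scheme" (structure)
  assumes mod: "Module.module scalar_field Z"
    and sub: "submodule E scalar_field Z"
    and p_add: "\<And>x y. \<lbrakk>x \<in> carrier Z; y \<in> carrier Z\<rbrakk> \<Longrightarrow> p (x \<oplus> y) \<le> p x + p y"
    and p_smult: "\<And>c x. \<lbrakk>x \<in> carrier Z; 0 \<le> c\<rbrakk> \<Longrightarrow> p (c \<odot> x) = c * p x"
    and f_add: "\<And>x y. \<lbrakk>x \<in> E; y \<in> E\<rbrakk> \<Longrightarrow> f (x \<oplus> y) = f x + f y"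
    and f_smult: "\<And>c x. x \<in> E \<Longrightarrow> f (c \<odot> x) = c * f x"
    and f_le: "\<And>x. x \<in> E \<Longrightarrow> f x \<le> p x"
  shows "\<exists>g. (\<forall>x\<in>carrier Z. \<forall>y\<in>carrier Z. g (x \<oplus> y) = g x + g y) \<and>
             (\<forall>c. \<forall>x\<in>carrier Z. g (c \<odot> x) = c * g x) \<and>
             (\<forall>x\<in>carrier Z. g x \<le> p x) \<and> (\<forall>x\<in>E. g x = (f x :: real))"
proof -
  interpret Z: Module.module scalar_field Z by fact
  define good where "good G \<longleftrightarrow> (\<forall>x\<in>E. (x, f x) \<in> G) \<and> G \<subseteq> carrier Z \<times> UNIV \<and>
      (\<forall>x a y b. (x, a) \<in> G \<longrightarrow> (y, b) \<in> G \<longrightarrow> (x \<oplus> y, a + b) \<in> G) \<and>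
      (\<forall>c x a. (x, a) \<in> G \<longrightarrow> (c \<odot> x, c * a) \<in> G) \<and>
      (\<forall>x a. (x, a) \<in> G \<longrightarrow> a \<le> p x)" for G :: "('z \<times> real) set"
  note E = Z.submoduleE[OF sub]
  have good0: "good ((\<lambda>x. (x, f x)) ` E)"
    unfolding good_def using E f_add f_smult f_le by auto
  have "\<exists>M\<in>Collect good. \<forall>G\<in>Collect good. M \<subseteq> G \<longrightarrow> G = M"
  proof (rule subset_Zorn_nonempty)
    show "Collect good \<noteq> {}" using good0 by blast
    fix \<C> assume ne: "\<C> \<noteq> {}" and ch: "subset.chain (Collect good) \<C>"
    have good: "good G" if "G \<in> \<C>" for G using ch that by (auto simp: subset.chain_def)
    have dir: "\<exists>K\<in>\<C>. G \<subseteq> K \<and> H \<subseteq> K" if "G \<in> \<C>" "H \<in> \<C>" for G H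
    proof -
      have "G \<subseteq> H \<or> H \<subseteq> G" using ch that by (simp add: subset_chain_def)
      then show ?thesis using that by auto
    qed
    have "(x \<oplus> y, a + b) \<in> \<Union>\<C>" if "(x, a) \<in> \<Union>\<C>" "(y, b) \<in> \<Union>\<C>" for x y a b
    proof -
      from that obtain G H where "G \<in> \<C>" "H \<in> \<C>" "(x, a) \<in> G" "(y, b) \<in> H" by blast
      with dir obtain K where "K \<in> \<C>" "(x, a) \<in> K" "(y, b) \<in> K" by blast
      moreover from \<open>K \<in> \<C>\<close> have "good K" by (rule good)
      ultimately have "(x \<oplus> y, a + b) \<in> K" unfolding good_def by simp
      with \<open>K \<in> \<C>\<close> show ?thesis by blast
    qed
    moreover have "(x, f x) \<in> \<Union>\<C>" if "x \<in> E" for x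
    proof -
      obtain G where "G \<in> \<C>" using ne by blast
      moreover from this have "(x, f x) \<in> G" using good[of G] that unfolding good_def by simp
      ultimately show ?thesis by blast
    qed
    moreover have "\<Union>\<C> \<subseteq> carrier Z \<times> UNIV"
    proof (rule Union_least)
      show "G \<subseteq> carrier Z \<times> UNIV" if "G \<in> \<C>" for G using good[OF that] unfolding good_def by simp
    qed
    moreover have "(c \<odot> x, c * a) \<in> \<Union>\<C>" if xa: "(x, a) \<in> \<Union>\<C>" for c x a
    proof -
      obtain G where "G \<in> \<C>" "(x, a) \<in> G" using xa by blast
      moreover from this have "(c \<odot> x, c * a) \<in> G" using good[of G] unfolding good_def by simp
      ultimately show ?thesis by blast
    qed
    moreover have "a \<le> p x" if xa: "(x, a) \<in> \<Union>\<C>" for x a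
    proof -
      obtain G where "G \<in> \<C>" "(x, a) \<in> G" using xa by blast
      then show ?thesis using good[of G] unfolding good_def by simp
    qed
    ultimately show "\<Union>\<C> \<in> Collect good" unfolding good_def mem_Collect_eq by (intro conjI allI ballI impI)
  qed
  then obtain M where M: "good M" and max: "\<And>G. good G \<Longrightarrow> M \<subseteq> G \<Longrightarrow> G = M" by blast
  have M_E: "\<And>x. x \<in> E \<Longrightarrow> (x, f x) \<in> M" and M_car: "\<And>x a. (x, a) \<in> M \<Longrightarrow> x \<in> carrier Z"
    and M_add: "\<And>x a y b. (x, a) \<in> M \<Longrightarrow> (y, b) \<in> M \<Longrightarrow> (x \<oplus> y, a + b) \<in> M"
    and M_smult: "\<And>c x a. (x, a) \<in> M \<Longrightarrow> (c \<odot> x, c * a) \<in> M"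
    and M_le: "\<And>x a. (x, a) \<in> M \<Longrightarrow> a \<le> p x"
    using M unfolding good_def by blast+
  have neg1: "(-1) \<odot> x = \<ominus> x" if "x \<in> carrier Z" for x
    using Z.smult_l_minus[of 1 x] Z.smult_one[of x] that by simp
  obtain e where e: "e \<in> E" using E(2) by blast
  have zero_M: "(\<zero>, 0) \<in> M"
    using M_smult[OF M_E[OF e], of 0] Z.smult_l_null[of e] E(1) e by auto
  have p0: "p \<zero> = 0"
    using p_smult[of "\<zero>" 0] Z.smult_r_null[of 0] by simp
  have M_fun_le: "a \<le> b" if "(x, a) \<in> M" "(x, b) \<in> M" for x a b
  proof -
    have "(x \<oplus> (-1) \<odot> x, a + (-1) * b) \<in> M" using that by (intro M_add M_smult)
    moreover have "x \<oplus> (-1) \<odot> x = \<zero>" using M_car[OF that(1)] by (simp add: neg1 Z.r_neg)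
    ultimately have "a + (-1) * b \<le> p \<zero>" using M_le by metis
    then show ?thesis using p0 by simp
  qed
  have M_fun: "a = b" if "(x, a) \<in> M" "(x, b) \<in> M" for x a b
    using M_fun_le that by (meson antisym)
  have dom: "\<exists>a. (y, a) \<in> M" if y: "y \<in> carrier Z" for y
  proof -
    have key: "a - p (x \<ominus> y) \<le> p (x' \<oplus> y) - b" if "(x, a) \<in> M" "(x', b) \<in> M" for x a x' b
    proof -
      have c: "x \<in> carrier Z" "x' \<in> carrier Z" using that M_car by auto
      have "a + b \<le> p (x \<oplus> x')" using M_le[OF M_add[OF that]] .
      also have "x \<oplus> x' = (x \<ominus> y) \<oplus> (x' \<oplus> y)"
      proof -
        have "(x \<ominus> y) \<oplus> (x' \<oplus> y) = x \<oplus> (\<ominus> y \<oplus> (y \<oplus> x'))"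
          using c y by (simp add: Z.minus_eq Z.a_assoc Z.a_comm[of x' y])
        also have "\<dots> = x \<oplus> x'" using c y by (simp add: Z.r_neg1)
        finally show ?thesis ..
      qed
      also have "p \<dots> \<le> p (x \<ominus> y) + p (x' \<oplus> y)" using c y by (intro p_add) auto
      finally show ?thesis by simp
    qed
    define \<xi> where "\<xi> = (SUP (x, a)\<in>M. a - p (x \<ominus> y))"
    have lo: "a - p (x \<ominus> y) \<le> \<xi>" if "(x, a) \<in> M" for x a
    proof -
      have "(case (x, a) of (x, a) \<Rightarrow> a - p (x \<ominus> y)) \<le> \<xi>" unfolding \<xi>_def
        by (rule cSUP_upper[OF that], rule bdd_aboveI2[where M = "p (\<zero> \<oplus> y) - 0"])
           (use key[OF _ zero_M] in auto)
      then show ?thesis by simp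
    qed
    have hi: "\<xi> \<le> p (x \<oplus> y) - a" if "(x, a) \<in> M" for x a
      unfolding \<xi>_def by (rule cSUP_least) (use zero_M key[OF _ that] in auto)
    define G where "G = {(x \<oplus> t \<odot> y, a + t * \<xi>) |x a t. (x, a) \<in> M}"
    have MG: "(x \<oplus> t \<odot> y, a + t * \<xi>) \<in> G" if "(x, a) \<in> M" for x a t
      using that unfolding G_def by blast
    have M_sub: "M \<subseteq> G"
    proof
      fix q assume q: "q \<in> M"
      obtain x a where "q = (x, a)" by (cases q)
      then show "q \<in> G" using MG[of x a 0] q M_car[of x a] y by (simp add: Z.smult_l_null[of y, simplified])
    qed
    have "good G" unfolding good_def
    proof (intro conjI allI ballI impI)
      show "(x, f x) \<in> G" if "x \<in> E" for x using M_sub M_E[OF that] by blast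
      show "G \<subseteq> carrier Z \<times> UNIV" using M_car y Z.smult_closed unfolding G_def by auto
    next
      fix x a x' b assume "(x, a) \<in> G" "(x', b) \<in> G"
      then obtain u v t w r s where u: "x = u \<oplus> t \<odot> y" "a = v + t * \<xi>" "(u, v) \<in> M"
        and w: "x' = w \<oplus> s \<odot> y" "b = r + s * \<xi>" "(w, r) \<in> M" unfolding G_def by blast
      have c: "u \<in> carrier Z" "w \<in> carrier Z" "t \<odot> y \<in> carrier Z" "s \<odot> y \<in> carrier Z"
        using u w M_car y Z.smult_closed by auto
      have "x \<oplus> x' = (u \<oplus> w) \<oplus> (t + s) \<odot> y"
      proof -
        have "(t + s) \<odot> y = t \<odot> y \<oplus> s \<odot> y" using Z.smult_l_distr[of t s y] y by simp
        then show ?thesis unfolding u w using c by (simp add: Z.a_assoc Z.a_lcomm)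
      qed
      moreover have "a + b = (v + r) + (t + s) * \<xi>" unfolding u w by (simp add: algebra_simps)
      ultimately show "(x \<oplus> x', a + b) \<in> G" using MG[OF M_add[OF u(3) w(3)], of "t + s"] by simp
    next
      fix k x a assume "(x, a) \<in> G"
      then obtain u v t where u: "x = u \<oplus> t \<odot> y" "a = v + t * \<xi>" "(u, v) \<in> M"
        unfolding G_def by blast
      have c: "u \<in> carrier Z" "t \<odot> y \<in> carrier Z" using u M_car y Z.smult_closed by auto
      have "k \<odot> x = k \<odot> u \<oplus> (k * t) \<odot> y"
        unfolding u using c y Z.smult_r_distr[of k] Z.smult_assoc1[of k t y] by simp
      moreover have "k * a = k * v + (k * t) * \<xi>" unfolding u by (simp add: algebra_simps)
      ultimately show "(k \<odot> x, k * a) \<in> G" using MG[OF M_smult[OF u(3)], of k "k * t"] by simp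
    next
      fix x a assume "(x, a) \<in> G"
      then obtain u v t where u: "x = u \<oplus> t \<odot> y" "a = v + t * \<xi>" "(u, v) \<in> M"
        unfolding G_def by blast
      have c: "u \<in> carrier Z" "t \<odot> y \<in> carrier Z" using u M_car y Z.smult_closed by auto
      consider "t = 0" | "t > 0" | "t < 0" by linarith
      then show "a \<le> p x"
      proof cases
        case 1
        then show ?thesis using u M_le[OF u(3)] c y Z.smult_l_null[of y] by simp
      next
        case 2
        let ?u = "inverse t \<odot> u"
        have cu: "?u \<in> carrier Z" using c Z.smult_closed by simp
        have "\<xi> \<le> p (?u \<oplus> y) - inverse t * v" using hi[OF M_smult[OF u(3)]] .
        then have "t * \<xi> \<le> t * (p (?u \<oplus> y) - inverse t * v)" using 2 by (intro mult_left_mono) auto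
        also have "\<dots> = t * p (?u \<oplus> y) - v" using 2 by (simp add: algebra_simps)
        also have "t * p (?u \<oplus> y) = p (t \<odot> (?u \<oplus> y))" using p_smult[of "?u \<oplus> y" t] 2 cu y by simp
        also have "t \<odot> (?u \<oplus> y) = x"
          using Z.smult_r_distr[of t ?u y] Z.smult_assoc1[of t "inverse t" u] Z.smult_one[of u] cu y c 2 u(1)
          by simp
        finally show ?thesis using u(2) by simp
      next
        case 3
        let ?s = "- t"
        let ?u = "inverse ?s \<odot> u"
        have cu: "?u \<in> carrier Z" using c Z.smult_closed by simp
        have "inverse ?s * v - p (?u \<ominus> y) \<le> \<xi>" using lo[OF M_smult[OF u(3)]] .
        then have "?s * (inverse ?s * v - p (?u \<ominus> y)) \<le> ?s * \<xi>" using 3 by (intro mult_left_mono) auto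
        moreover have "?s * (inverse ?s * v - p (?u \<ominus> y)) = v - ?s * p (?u \<ominus> y)"
          using 3 by (simp add: algebra_simps)
        moreover have "?s * p (?u \<ominus> y) = p (?s \<odot> (?u \<ominus> y))"
          using p_smult[of "?u \<ominus> y" ?s] 3 cu y by simp
        moreover have "?s \<odot> (?u \<ominus> y) = x"
        proof -
          have "?s \<odot> (?u \<ominus> y) = ?s \<odot> ?u \<oplus> ?s \<odot> ((-1) \<odot> y)"
            using Z.smult_r_distr[of ?s ?u "(-1) \<odot> y"] cu y Z.smult_closed[of "-1" y]
            by (simp add: Z.minus_eq neg1)
          also have "?s \<odot> ((-1) \<odot> y) = t \<odot> y" using Z.smult_assoc1[of ?s "-1" y] y by simp
          also have "?s \<odot> ?u = u"
            using Z.smult_assoc1[of ?s "inverse ?s" u] Z.smult_one[of u] c 3 by simp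
          finally show ?thesis using u(1) by simp
        qed
        ultimately show ?thesis using u(2) by simp
      qed
    qed
    then have "G = M" using max M_sub by blast
    moreover have "(\<zero> \<oplus> 1 \<odot> y, 0 + 1 * \<xi>) \<in> G" using MG[OF zero_M] .
    ultimately show ?thesis using y Z.smult_one[of y] by auto
  qed
  define g where "g x = (THE a. (x, a) \<in> M)" for x
  have gM: "g x = a" if "(x, a) \<in> M" for x a
    unfolding g_def by (rule the_equality[of "\<lambda>a. (x, a) \<in> M", OF that M_fun[of x, OF _ that]])
  have g: "(x, g x) \<in> M" if "x \<in> carrier Z" for x
  proof -
    from dom[OF that] obtain a where "(x, a) \<in> M" by blast
    then show ?thesis using gM[of x a] by simp
  qed
  show ?thesis
  proof (intro exI[of _ g] conjI ballI allI)
    show "g (x \<oplus> y) = g x + g y" if "x \<in> carrier Z" "y \<in> carrier Z" for x y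
      by (rule gM[OF M_add[OF g[OF that(1)] g[OF that(2)]]])
    show "g (c \<odot> x) = c * g x" if "x \<in> carrier Z" for c x
      by (rule gM[OF M_smult[OF g[OF that]]])
    show "g x \<le> p x" if "x \<in> carrier Z" for x by (rule M_le[OF g[OF that]])
    show "g x = f x" if "x \<in> E" for x by (rule gM[OF M_E[OF that]])
  qed
qed


definition bounded_functional ::
  "('k::real_normed_field, 'z) normed_module \<Rightarrow> 'z set \<Rightarrow> real \<Rightarrow> ('z \<Rightarrow> 'k) \<Rightarrow> bool" where
  "bounded_functional Z E C f \<longleftrightarrow>
     (\<forall>x\<in>E. \<forall>y\<in>E. f (x \<oplus>\<^bsub>Z\<^esub> y) = f x + f y) \<and>
     (\<forall>c. \<forall>x\<in>E. f (c \<odot>\<^bsub>Z\<^esub> x) = c * f x) \<and>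
     (\<forall>x\<in>E. norm (f x) \<le> C * vnorm Z x)"

definition hahn_banach :: "('k::real_normed_field, 'z) normed_module \<Rightarrow> bool" where
  "hahn_banach Z \<longleftrightarrow>
     (\<forall>E C f. submodule E scalar_field Z \<longrightarrow> 0 \<le> C \<longrightarrow> bounded_functional Z E C f \<longrightarrow>
        (\<exists>g. bounded_functional Z (carrier Z) C g \<and> (\<forall>x\<in>E. g x = f x)))"

lemma hahn_banach_real:
  fixes Z :: "(real, 'z) normed_module" (structure)
  assumes Z: "normed_vector_space Z"
  shows "hahn_banach Z"
  unfolding hahn_banach_def
proof (intro allI impI)
  fix E C f
  assume E: "submodule E scalar_field Z" and C: "0 \<le> C" and f: "bounded_functional Z E C f"
  interpret Z: normed_vector_space Z by fact
  have "\<exists>g. (\<forall>x\<in>carrier Z. \<forall>y\<in>carrier Z. g (x \<oplus> y) = g x + g y) \<and>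
             (\<forall>c. \<forall>x\<in>carrier Z. g (c \<odot> x) = c * g x) \<and>
             (\<forall>x\<in>carrier Z. g x \<le> C * vnorm Z x) \<and> (\<forall>x\<in>E. g x = f x)"
  proof (rule hahn_banach_sublinear[OF Z.module_axioms E])
    show "C * vnorm Z (x \<oplus> y) \<le> C * vnorm Z x + C * vnorm Z y"
      if "x \<in> carrier Z" "y \<in> carrier Z" for x y
      using mult_left_mono[OF Z.vnorm_triangle[OF that] C] by (simp add: distrib_left)
    show "C * vnorm Z (c \<odot> x) = c * (C * vnorm Z x)" if "x \<in> carrier Z" "0 \<le> c" for c x
      using Z.vnorm_smult[OF that(1), of c] that(2) by simp
    show "f x \<le> C * vnorm Z x" if "x \<in> E" for x
      using f that unfolding bounded_functional_def by (force simp: abs_le_iff)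
  qed (use f in \<open>auto simp: bounded_functional_def\<close>)
  then obtain g where g: "\<And>x y. x \<in> carrier Z \<Longrightarrow> y \<in> carrier Z \<Longrightarrow> g (x \<oplus> y) = g x + g y"
      "\<And>c x. x \<in> carrier Z \<Longrightarrow> g (c \<odot> x) = c * g x"
      "\<And>x. x \<in> carrier Z \<Longrightarrow> g x \<le> C * vnorm Z x" "\<And>x. x \<in> E \<Longrightarrow> g x = f x" by blast
  have "norm (g x) \<le> C * vnorm Z x" if x: "x \<in> carrier Z" for x
  proof -
    have "(-1) \<odot> x \<in> carrier Z" using x Z.smult_closed by simp
    from g(3)[OF this] have "- g x \<le> C * vnorm Z x" using g(2)[OF x, of "-1"] Z.vnorm_smult[OF x, of "-1"] by simp
    then show ?thesis using g(3)[OF x] by (simp add: abs_le_iff)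
  qed
  then show "\<exists>g. bounded_functional Z (carrier Z) C g \<and> (\<forall>x\<in>E. g x = f x)"
    using g unfolding bounded_functional_def by blast
qed

lemma hahn_banach_complex:
  fixes Z :: "(complex, 'z) normed_module" (structure)
  assumes Z: "normed_vector_space Z"
  shows "hahn_banach Z"
  unfolding hahn_banach_def
proof (intro allI impI)
  fix E C f
  assume E: "submodule E scalar_field Z" and C: "0 \<le> C" and f: "bounded_functional Z E C f"
  interpret Z: normed_vector_space Z by fact
  define R :: "(real, 'z) module" where
    "R = \<lparr>carrier = carrier Z, monoid.mult = monoid.mult Z, one = one Z, ring.zero = ring.zero Z,
          add = add Z, module.smult = (\<lambda>r x. complex_of_real r \<odot> x)\<rparr>"
  have R [simp]: "carrier R = carrier Z" "x \<oplus>\<^bsub>R\<^esub> y = x \<oplus> y" "\<zero>\<^bsub>R\<^esub> = \<zero>"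
    "r \<odot>\<^bsub>R\<^esub> x = complex_of_real r \<odot> x" for x y r by (simp_all add: R_def)
  have ab: "abelian_group R"
  proof (rule abelian_groupI)
    show "\<exists>y\<in>carrier R. y \<oplus>\<^bsub>R\<^esub> x = \<zero>\<^bsub>R\<^esub>" if "x \<in> carrier R" for x
      using that by (intro bexI[of _ "\<ominus> x"]) (auto simp: Z.l_neg)
  qed (auto simp: Z.a_assoc Z.a_comm Z.a_lcomm)
  have mod: "Module.module scalar_field R"
    by (rule moduleI[OF cring_scalar_field ab])
       (use Z.smult_closed Z.smult_l_distr Z.smult_r_distr Z.smult_assoc1 Z.smult_one in auto)
  interpret R: Module.module scalar_field R by fact
  note E' = Z.submoduleE[OF E]
  have zero_E: "\<zero> \<in> E" 
  proof -
    obtain e where "e \<in> E" using E'(2) by blast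
    then show ?thesis using E'(4)[of 0 e] E'(1) Z.smult_l_null[of e] by auto
  qed
  have inv: "\<ominus>\<^bsub>R\<^esub> x = \<ominus> x" if "x \<in> carrier Z" for x
    using R.minus_equality[of "\<ominus> x" x] that by (simp add: Z.l_neg)
  have ER: "submodule E scalar_field R"
    using E' zero_E inv by (intro R.submoduleI) auto
  have "\<exists>g. (\<forall>x\<in>carrier R. \<forall>y\<in>carrier R. g (x \<oplus>\<^bsub>R\<^esub> y) = g x + g y) \<and>
             (\<forall>c. \<forall>x\<in>carrier R. g (c \<odot>\<^bsub>R\<^esub> x) = c * g x) \<and>
             (\<forall>x\<in>carrier R. g x \<le> C * vnorm Z x) \<and> (\<forall>x\<in>E. g x = Re (f x))"
  proof (rule hahn_banach_sublinear[OF mod ER])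
    show "C * vnorm Z (x \<oplus>\<^bsub>R\<^esub> y) \<le> C * vnorm Z x + C * vnorm Z y"
      if "x \<in> carrier R" "y \<in> carrier R" for x y
      using mult_left_mono[OF Z.vnorm_triangle C, of x y] that by (simp add: distrib_left)
    show "C * vnorm Z (c \<odot>\<^bsub>R\<^esub> x) = c * (C * vnorm Z x)" if "x \<in> carrier R" "0 \<le> c" for c x
      using Z.vnorm_smult[of x "complex_of_real c"] that by simp
    show "Re (f x) \<le> C * vnorm Z x" if "x \<in> E" for x
      using f that complex_Re_le_cmod[of "f x"] unfolding bounded_functional_def by force
  qed (use f in \<open>auto simp: bounded_functional_def\<close>)
  then obtain g where g: "\<And>x y. x \<in> carrier Z \<Longrightarrow> y \<in> carrier Z \<Longrightarrow> g (x \<oplus> y) = g x + g y"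
      "\<And>c x. x \<in> carrier Z \<Longrightarrow> g (complex_of_real c \<odot> x) = c * g x"
      "\<And>x. x \<in> carrier Z \<Longrightarrow> g x \<le> C * vnorm Z x" "\<And>x. x \<in> E \<Longrightarrow> g x = Re (f x)" unfolding R by blast
  define h where "h x = Complex (g x) (- g (\<i> \<odot> x))" for x
  have sc: "c \<odot> x \<in> carrier Z" if "x \<in> carrier Z" for c x using that Z.smult_closed by simp
  have h_add: "h (x \<oplus> y) = h x + h y" if "x \<in> carrier Z" "y \<in> carrier Z" for x y
    unfolding h_def using that g(1) sc Z.smult_r_distr[of \<i> x y] by (simp add: complex_eq_iff)
  have h_smult: "h (c \<odot> x) = c * h x" if x: "x \<in> carrier Z" for c x
  proof -
    have gc: "g (c \<odot> x) = Re c * g x + Im c * g (\<i> \<odot> x)" for c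
    proof -
      have "c \<odot> x = (complex_of_real (Re c) + complex_of_real (Im c) * \<i>) \<odot> x"
        using complex_eq[of c] by (simp add: mult.commute)
      also have "\<dots> = complex_of_real (Re c) \<odot> x \<oplus> complex_of_real (Im c) \<odot> (\<i> \<odot> x)"
        using Z.smult_l_distr[of "complex_of_real (Re c)" "complex_of_real (Im c) * \<i>" x]
          Z.smult_assoc1[of "complex_of_real (Im c)" \<i> x] x by simp
      finally show ?thesis using g(1,2) sc x by simp
    qed
    have "g (\<i> \<odot> (c \<odot> x)) = g ((\<i> * c) \<odot> x)" using Z.smult_assoc1[of \<i> c x] x by simp
    then show ?thesis unfolding h_def using gc[of c] gc[of "\<i> * c"]
      by (simp add: complex_eq_iff algebra_simps)
  qed
  have h_le: "norm (h x) \<le> C * vnorm Z x" if x: "x \<in> carrier Z" for x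
  proof -
    define u where "u = cnj (sgn (h x))"
    have "u * h x = complex_of_real (norm (h x))"
    proof (cases "h x = 0")
      case False
      then show ?thesis unfolding u_def sgn_div_norm
        using complex_norm_square[of "h x"]
        by (simp add: scaleR_conv_of_real field_simps power2_eq_square)
    qed (simp add: u_def)
    then have "norm (h x) = Re (h (u \<odot> x))" using h_smult[OF x] by simp
    also have "\<dots> = g (u \<odot> x)" by (simp add: h_def)
    also have "\<dots> \<le> C * (norm u * vnorm Z x)" using g(3)[OF sc[OF x]] Z.vnorm_smult[OF x] by simp
    also have "\<dots> \<le> C * (1 * vnorm Z x)"
      using C Z.vnorm_nonneg[OF x] unfolding u_def
      by (intro mult_left_mono mult_right_mono) (auto simp: norm_sgn)
    finally show ?thesis by simp
  qed
  have "h x = f x" if "x \<in> E" for x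
  proof -
    have "f (\<i> \<odot> x) = \<i> * f x" using f that unfolding bounded_functional_def by blast
    then show ?thesis using g(4)[OF that] g(4)[OF E'(4)[of \<i> x]] that by (simp add: h_def complex_eq_iff)
  qed
  then show "\<exists>g. bounded_functional Z (carrier Z) C g \<and> (\<forall>x\<in>E. g x = f x)"
    using h_add h_smult h_le unfolding bounded_functional_def by blast
qed

definition linf :: "('k::real_normed_field, 'i \<Rightarrow> 'k) normed_module" where
  "linf = \<lparr>carrier = {f. bounded (range f)}, monoid.mult = (\<lambda>f g i. f i * g i), one = (\<lambda>i. 1),
           ring.zero = (\<lambda>i. 0), add = (\<lambda>f g i. f i + g i), module.smult = (\<lambda>c f i. c * f i),
           vnorm = (\<lambda>f. SUP i. norm (f i))\<rparr>"

lemma linf_simps [simp]: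
  "f \<in> carrier linf \<longleftrightarrow> bounded (range f)" "f \<oplus>\<^bsub>linf\<^esub> g = (\<lambda>i. f i + g i)"
  "\<zero>\<^bsub>linf\<^esub> = (\<lambda>i. 0)" "c \<odot>\<^bsub>linf\<^esub> f = (\<lambda>i. c * f i)"
  by (simp_all add: linf_def)

lemma vnorm_linf: "vnorm linf f = (SUP i. norm (f i))"
  by (simp add: linf_def)

lemma vnorm_linf_ge: "bounded (range f) \<Longrightarrow> norm (f i) \<le> vnorm linf f"
  unfolding vnorm_linf by (rule cSUP_upper) (auto simp: bounded_iff bdd_above_def)

lemma vnorm_linf_le: "(\<And>i. norm (f i) \<le> C) \<Longrightarrow> vnorm linf f \<le> C"
  unfolding vnorm_linf by (rule cSUP_least) auto

lemma bounded_range_add: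
  "bounded (range f) \<Longrightarrow> bounded (range g) \<Longrightarrow> bounded (range (\<lambda>i. f i + g i :: 'k::real_normed_vector))"
  using bounded_plus_comp by blast

lemma bounded_range_mult:
  "bounded (range f) \<Longrightarrow> bounded (range (\<lambda>i. c * f i :: 'k::real_normed_field))"
  by (metis bounded_linear_image bounded_linear_mult_right image_image)

lemma abelian_group_linf: "abelian_group (linf :: ('k::real_normed_field, 'i \<Rightarrow> 'k) normed_module)"
proof (rule abelian_groupI)
  show "\<exists>g\<in>carrier linf. g \<oplus>\<^bsub>linf\<^esub> f = \<zero>\<^bsub>linf\<^esub>" if "f \<in> carrier linf" for f :: "'i \<Rightarrow> 'k"
    using that bounded_range_mult[of f "-1"] by (intro bexI[of _ "\<lambda>i. - f i"]) auto
qed (auto simp: bounded_range_add algebra_simps)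

lemma normed_vector_space_linf:
  "normed_vector_space (linf :: ('k::real_normed_field, 'i \<Rightarrow> 'k) normed_module)"
proof -
  have "Module.module scalar_field (linf :: ('k, 'i \<Rightarrow> 'k) normed_module)"
    by (rule moduleI[OF cring_scalar_field abelian_group_linf])
       (auto simp: bounded_range_mult algebra_simps)
  moreover have "normed_vector_space_axioms (linf :: ('k, 'i \<Rightarrow> 'k) normed_module)"
  proof
    fix f :: "'i \<Rightarrow> 'k" assume "f \<in> carrier linf"
    then have b: "bounded (range f)" by simp
    show "vnorm linf f = 0 \<longleftrightarrow> f = \<zero>\<^bsub>linf\<^esub>"
      using vnorm_linf_ge[OF b] by (auto simp: vnorm_linf fun_eq_iff)
    show "vnorm linf (c \<odot>\<^bsub>linf\<^esub> f) = norm c * vnorm linf f" for c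
    proof (rule antisym)
      show "vnorm linf (c \<odot>\<^bsub>linf\<^esub> f) \<le> norm c * vnorm linf f"
        by (rule vnorm_linf_le) (auto simp: norm_mult intro!: mult_left_mono vnorm_linf_ge b)
      show "norm c * vnorm linf f \<le> vnorm linf (c \<odot>\<^bsub>linf\<^esub> f)"
      proof (cases "c = 0")
        case False
        have "vnorm linf f \<le> vnorm linf (c \<odot>\<^bsub>linf\<^esub> f) / norm c"
        proof (rule vnorm_linf_le)
          fix i
          show "norm (f i) \<le> vnorm linf (c \<odot>\<^bsub>linf\<^esub> f) / norm c"
            using vnorm_linf_ge[OF bounded_range_mult[OF b], of c i] False
            by (simp add: norm_mult field_simps)
        qed
        then show ?thesis using False by (simp add: field_simps)
      qed (simp add: vnorm_linf)
    qed
    fix g :: "'i \<Rightarrow> 'k" assume "g \<in> carrier linf"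
    then have b': "bounded (range g)" by simp
    show "vnorm linf (f \<oplus>\<^bsub>linf\<^esub> g) \<le> vnorm linf f + vnorm linf g"
    proof (rule vnorm_linf_le)
      fix i
      show "norm ((f \<oplus>\<^bsub>linf\<^esub> g) i) \<le> vnorm linf f + vnorm linf g"
        using norm_triangle_ineq[of "f i" "g i"] vnorm_linf_ge[OF b, of i] vnorm_linf_ge[OF b', of i]
        by simp
    qed
  qed
  ultimately show ?thesis by (rule normed_vector_space.intro)
qed

lemma a_minus_linf:
  assumes "bounded (range f)" "bounded (range g)"
  shows "f \<ominus>\<^bsub>linf\<^esub> g = (\<lambda>i. f i - g i :: 'k::real_normed_field)"
proof -
  interpret normed_vector_space linf by (rule normed_vector_space_linf)
  have "bounded (range (\<lambda>i. - g i))" using bounded_range_mult[OF assms(2), of "-1"] by simp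
  then have "\<ominus>\<^bsub>linf\<^esub> g = (\<lambda>i. - g i)" using assms(2) by (intro minus_equality) auto
  then show ?thesis using assms by (simp add: minus_eq)
qed

lemma banach_space_linf:
  "banach_space (linf :: ('k::{real_normed_field, banach}, 'i \<Rightarrow> 'k) normed_module)"
proof (rule banach_space.intro[OF normed_vector_space_linf], unfold_locales)
  fix s :: "nat \<Rightarrow> 'i \<Rightarrow> 'k"
  assume "\<And>n. s n \<in> carrier linf"
  then have b: "bounded (range (s n))" for n by simp
  assume cau: "\<forall>e>0. \<exists>N. \<forall>m\<ge>N. \<forall>n\<ge>N. vnorm linf (s m \<ominus>\<^bsub>linf\<^esub> s n) < e"
  have bm: "bounded (range (\<lambda>i. s m i - s n i))" for m n
    using bounded_range_add[OF b[of m] bounded_range_mult[OF b[of n], of "-1"]] by simp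
  have ev: "\<exists>N. \<forall>m\<ge>N. \<forall>n\<ge>N. \<forall>i. norm (s m i - s n i) < e" if "e > 0" for e
  proof -
    obtain N where N: "\<forall>m\<ge>N. \<forall>n\<ge>N. vnorm linf (s m \<ominus>\<^bsub>linf\<^esub> s n) < e" using cau \<open>e > 0\<close> by blast
    have "norm (s m i - s n i) < e" if "m \<ge> N" "n \<ge> N" for m n i
      using vnorm_linf_ge[OF bm[of m n], of i] N that by (auto simp: a_minus_linf b intro: le_less_trans)
    then show ?thesis by blast
  qed
  have "Cauchy (\<lambda>n. s n i)" for i
  proof (rule CauchyI)
    fix e :: real assume "e > 0"
    from ev[OF this] show "\<exists>N. \<forall>m\<ge>N. \<forall>n\<ge>N. norm (s m i - s n i) < e" by blast
  qed
  then have "\<exists>L. (\<lambda>n. s n i) \<longlonglongrightarrow> L" for i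
    using convergentD[OF Cauchy_convergent] by blast
  then obtain l where l: "\<And>i. (\<lambda>n. s n i) \<longlonglongrightarrow> l i" by metis
  have lim: "\<exists>N. \<forall>n\<ge>N. \<forall>i. norm (s n i - l i) \<le> e" if "e > 0" for e
  proof -
    obtain N where N: "\<forall>m\<ge>N. \<forall>n\<ge>N. \<forall>i. norm (s m i - s n i) < e" using ev \<open>e > 0\<close> by blast
    have "norm (s n i - l i) \<le> e" if "n \<ge> N" for n i
    proof (rule tendsto_upperbound)
      show "(\<lambda>m. norm (s n i - s m i)) \<longlonglongrightarrow> norm (s n i - l i)" by (intro tendsto_intros l)
      show "\<forall>\<^sub>F m in sequentially. norm (s n i - s m i) \<le> e"
        using N that by (intro eventually_sequentiallyI[of N]) (auto intro: less_imp_le)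
    qed simp
    then show ?thesis by blast
  qed
  obtain N where N: "\<forall>n\<ge>N. \<forall>i. norm (s n i - l i) \<le> 1" using lim[of 1] by auto
  have "bounded (range (\<lambda>i. s N i - l i))" using N by (auto simp: bounded_iff)
  from bounded_range_add[OF b[of N] bounded_range_mult[OF this, of "-1"]]
  have bl: "bounded (range l)" by simp
  moreover have "(\<lambda>n. vnorm linf (s n \<ominus>\<^bsub>linf\<^esub> l)) \<longlonglongrightarrow> 0"
  proof (rule LIMSEQ_I)
    fix e :: real assume "e > 0"
    then obtain N where N: "\<forall>n\<ge>N. \<forall>i. norm (s n i - l i) \<le> e / 2" using lim[of "e / 2"] by auto
    have "norm (vnorm linf (s n \<ominus>\<^bsub>linf\<^esub> l) - 0) < e" if "n \<ge> N" for n
    proof -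
      have "vnorm linf (\<lambda>i. s n i - l i) \<le> e / 2" using N that by (intro vnorm_linf_le) auto
      moreover have "0 \<le> vnorm linf (\<lambda>i. s n i - l i)"
        using bounded_range_add[OF b[of n] bounded_range_mult[OF bl, of "-1"]]
        by (intro normed_vector_space.vnorm_nonneg[OF normed_vector_space_linf]) simp
      ultimately show ?thesis using \<open>e > 0\<close> by (simp add: a_minus_linf b bl)
    qed
    then show "\<exists>no. \<forall>n\<ge>no. norm (vnorm linf (s n \<ominus>\<^bsub>linf\<^esub> l) - 0) < e" by blast
  qed
  ultimately show "\<exists>l\<in>carrier linf. (\<lambda>n. vnorm linf (s n \<ominus>\<^bsub>linf\<^esub> l)) \<longlonglongrightarrow> 0" by auto
qed

lemma norming_functional:
  fixes X :: "('k::real_normed_field, 'x) normed_module" (structure)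
  assumes X: "normed_vector_space X" and hb: "hahn_banach X" and x: "x \<in> carrier X"
  shows "\<exists>\<phi>. bounded_functional X (carrier X) 1 \<phi> \<and> \<phi> x = of_real (vnorm X x)"
proof (cases "x = \<zero>")
  interpret X: normed_vector_space X by fact
  case True
  then have "bounded_functional X (carrier X) 1 (\<lambda>_. 0) \<and> 0 = of_real (vnorm X x)"
    using X.vnorm_nonneg unfolding bounded_functional_def by simp
  then show ?thesis by blast
next
  interpret X: normed_vector_space X by fact
  case False
  define E where "E = range (\<lambda>c. c \<odot> x)"
  have sc: "c \<odot> x \<in> carrier X" for c using x X.smult_closed by simp
  have inj: "c = d" if "c \<odot> x = d \<odot> x" for c d
  proof -
    have "(c - d) \<odot> x = c \<odot> x \<oplus> (- d) \<odot> x" using X.smult_l_distr[of c "- d" x] x by simp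
    also have "(- d) \<odot> x = \<ominus> (d \<odot> x)" using X.smult_l_minus[of d x] x by simp
    also have "c \<odot> x \<oplus> \<ominus> (d \<odot> x) = \<zero>" using that sc by (simp add: X.r_neg)
    finally have "norm (c - d) * vnorm X x = 0" using X.vnorm_smult[OF x, of "c - d"] by simp
    then show ?thesis using False X.vnorm_eq_0_iff[OF x] by simp
  qed
  define f where "f y = (THE c. y = c \<odot> x) * of_real (vnorm X x)" for y
  have f: "f (c \<odot> x) = c * of_real (vnorm X x)" for c
    unfolding f_def using the_equality[of "\<lambda>d. c \<odot> x = d \<odot> x" c] inj by fastforce
  have add: "c \<odot> x \<oplus> d \<odot> x = (c + d) \<odot> x" for c d using X.smult_l_distr[of c d x] x by simp
  have mul: "c \<odot> (d \<odot> x) = (c * d) \<odot> x" for c d using X.smult_assoc1[of c d x] x by simp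
  have neg: "\<ominus> (c \<odot> x) = (- c) \<odot> x" for c using X.smult_l_minus[of c x] x by simp
  have zero: "\<zero> = 0 \<odot> x" using X.smult_l_null[of x] x by simp
  have "submodule E scalar_field X"
    by (rule X.submoduleI) (auto simp: E_def sc add mul neg zero)
  moreover have "bounded_functional X E 1 f"
    unfolding bounded_functional_def E_def
    using X.vnorm_smult[OF x] X.vnorm_nonneg[OF x]
    by (auto simp: add mul f norm_mult algebra_simps)
  ultimately obtain g where g: "bounded_functional X (carrier X) 1 g" "\<forall>y\<in>E. g y = f y"
    using hb unfolding hahn_banach_def by (metis zero_le_one)
  have "x = 1 \<odot> x" using X.smult_one[of x] x by simp
  then have "x \<in> E" "f x = of_real (vnorm X x)" using f[of 1] unfolding E_def by (blast, simp)
  then show ?thesis using g by auto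
qed

lemma injective_universal:
  fixes X :: "('k::{real_normed_field, banach}, 'x) normed_module" (structure)
  assumes X: "banach_space X" and lam: "0 \<le> lam" and inj: "injective lam X"
    and hbX: "hahn_banach X"
    and hbZ: "\<And>Z :: ('k, 'z) normed_module. normed_vector_space Z \<Longrightarrow> hahn_banach Z"
  shows "injective_wrt TYPE('z) lam X"
proof -
  interpret X: banach_space X by fact
  note nX = X.normed_vector_space_axioms
  let ?L = "linf :: ('k, 'x \<Rightarrow> 'k) normed_module"
  interpret L: normed_vector_space ?L by (rule normed_vector_space_linf)
  obtain \<phi> where \<phi>: "\<And>x. x \<in> carrier X \<Longrightarrow> bounded_functional X (carrier X) 1 (\<phi> x)"
    "\<And>x. x \<in> carrier X \<Longrightarrow> \<phi> x x = of_real (vnorm X x)"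
    using norming_functional[OF nX hbX] by metis
  have \<phi>_add: "\<phi> i (x \<oplus> y) = \<phi> i x + \<phi> i y"
    and \<phi>_smult: "\<phi> i (c \<odot> x) = c * \<phi> i x"
    and \<phi>_le: "norm (\<phi> i x) \<le> vnorm X x"
    if "i \<in> carrier X" "x \<in> carrier X" "y \<in> carrier X" for i c x y
    using \<phi>(1)[OF that(1)] that unfolding bounded_functional_def by auto
  define J where "J x i = (if i \<in> carrier X then \<phi> i x else 0)" for x i
  have J_bd: "norm (J x i) \<le> vnorm X x" if "x \<in> carrier X" for x i
    using \<phi>_le[OF _ that that] X.vnorm_nonneg[OF that] by (simp add: J_def)
  have J_car: "bounded (range (J x))" if "x \<in> carrier X" for x
    using J_bd[OF that] by (auto simp: bounded_iff)
  have J_norm: "vnorm ?L (J x) = vnorm X x" if x: "x \<in> carrier X" for x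
  proof (rule antisym)
    show "vnorm ?L (J x) \<le> vnorm X x" by (rule vnorm_linf_le) (rule J_bd[OF x])
    show "vnorm X x \<le> vnorm ?L (J x)"
      using vnorm_linf_ge[OF J_car[OF x], of x] \<phi>(2)[OF x] x X.vnorm_nonneg[OF x] by (simp add: J_def)
  qed
  have J_add: "(\<lambda>i. J x i + J y i) = J (x \<oplus> y)" if "x \<in> carrier X" "y \<in> carrier X" for x y
    using \<phi>_add[OF _ that] by (auto simp: J_def fun_eq_iff)
  have J_smult: "(\<lambda>i. c * J x i) = J (c \<odot> x)" if "x \<in> carrier X" for c x
    using \<phi>_smult[OF _ that that] by (auto simp: J_def fun_eq_iff)
  have sX: "c \<odot> x \<in> carrier X" if "x \<in> carrier X" for c x using that X.smult_closed by simp
  define E0 where "E0 = J ` carrier X"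
  have E0: "submodule E0 scalar_field ?L"
  proof (rule L.submoduleI)
    show "E0 \<subseteq> carrier ?L" using J_car by (auto simp: E0_def)
    show add: "f \<oplus>\<^bsub>?L\<^esub> g \<in> E0" if "f \<in> E0" "g \<in> E0" for f g
      using that J_add by (auto simp: E0_def)
    show sm: "c \<odot>\<^bsub>?L\<^esub> f \<in> E0" if "f \<in> E0" for c f
      using that J_smult sX by (auto simp: E0_def)
    have "J \<zero> \<in> E0" by (simp add: E0_def)
    from sm[OF this, of 0] show "\<zero>\<^bsub>?L\<^esub> \<in> E0" by simp
    fix f assume f: "f \<in> E0"
    then have "f \<in> carrier ?L" using J_car by (auto simp: E0_def)
    then show "\<ominus>\<^bsub>?L\<^esub> f \<in> E0" using sm[OF f, of "-1"] L.smult_neg_one[of f] by metis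
  qed
  have J_inj: "x = y" if "x \<in> carrier X" "y \<in> carrier X" "J x = J y" for x y
  proof -
    have "J (x \<oplus> (-1) \<odot> y) = (\<lambda>i. J x i + (-1) * J y i)"
      using J_add[OF that(1) sX[OF that(2)], of "-1"] J_smult[OF that(2), of "-1"] by metis
    then have "vnorm ?L (J (x \<oplus> (-1) \<odot> y)) = 0" using that(3) by (simp add: vnorm_linf)
    then have "x \<oplus> (-1) \<odot> y = \<zero>"
      using J_norm[of "x \<oplus> (-1) \<odot> y"] X.vnorm_eq_0_iff[of "x \<oplus> (-1) \<odot> y"] that sX[of y "-1"] by simp
    then have "x \<oplus> \<ominus> y = \<zero>" using X.smult_neg_one[OF that(2)] by simp
    then have "\<ominus> (\<ominus> y) = x" using that by (intro X.minus_equality) auto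
    then show ?thesis using that by simp
  qed
  define T0 where "T0 f = (THE x. x \<in> carrier X \<and> J x = f)" for f
  have T0: "T0 (J x) = x" if "x \<in> carrier X" for x
    unfolding T0_def by (rule the_equality) (use that J_inj in auto)
  have T0_bd: "vnorm X (T0 f) \<le> 1 * vnorm (?L\<lparr>carrier := E0\<rparr>) f" if "f \<in> E0" for f
    using that T0 J_norm by (auto simp: E0_def)
  have T0_op: "bounded_operator (?L\<lparr>carrier := E0\<rparr>) X T0"
    unfolding bounded_operator_def
  proof (intro conjI)
    show "\<exists>C. \<forall>f\<in>carrier (?L\<lparr>carrier := E0\<rparr>). vnorm X (T0 f) \<le> C * vnorm (?L\<lparr>carrier := E0\<rparr>) f"
      using T0_bd by (intro exI[of _ 1]) simp
  qed (auto simp: E0_def T0 J_add J_smult sX)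
  have nE0: "normed_vector_space (?L\<lparr>carrier := E0\<rparr>)"
    by (rule normed_vector_space_submodule[OF normed_vector_space_linf E0])
  have T0_norm: "op_norm (?L\<lparr>carrier := E0\<rparr>) X T0 \<le> 1"
    by (rule op_norm_le[OF nE0]) (use T0_bd in auto)
  obtain P where P: "bounded_operator ?L X P" "\<And>f. f \<in> E0 \<Longrightarrow> P f = T0 f"
    and P_norm: "op_norm ?L X P \<le> lam * op_norm (?L\<lparr>carrier := E0\<rparr>) X T0"
    using inj banach_space_linf E0 T0_op unfolding injective_def injective_wrt_def by blast
  have "lam * op_norm (?L\<lparr>carrier := E0\<rparr>) X T0 \<le> lam * 1"
    by (rule mult_left_mono[OF T0_norm lam])
  with P_norm have P_norm: "op_norm ?L X P \<le> lam" by simp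
  have PJ: "P (J x) = x" if "x \<in> carrier X" for x
    using P(2)[of "J x"] T0[OF that] that by (simp add: E0_def)
  have P_car: "P f \<in> carrier X" and P_add: "bounded (range g) \<Longrightarrow> P (\<lambda>i. f i + g i) = P f \<oplus> P g"
    and P_smult: "P (\<lambda>i. c * f i) = c \<odot> P f" if "bounded (range f)" for f g c
    using P(1) that unfolding bounded_operator_def by (auto simp: Pi_iff)
  have P_le: "vnorm X (P f) \<le> lam * vnorm ?L f" if "bounded (range f)" for f
  proof -
    have f: "f \<in> carrier ?L" using that by simp
    have "vnorm X (P f) \<le> op_norm ?L X P * vnorm ?L f"
      by (rule bounded_operator_bound[OF normed_vector_space_linf P(1) f])
    also have "\<dots> \<le> lam * vnorm ?L f"
      by (rule mult_right_mono[OF P_norm L.vnorm_nonneg[OF f]])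
    finally show ?thesis .
  qed
  show ?thesis unfolding injective_wrt_def
  proof (intro allI impI)
    fix Z :: "('k, 'z) normed_module" and E T
    assume Z: "banach_space Z" and E: "submodule E scalar_field Z"
      and T: "bounded_operator (Z\<lparr>carrier := E\<rparr>) X T"
    interpret Z: banach_space Z by fact
    note nZ = Z.normed_vector_space_axioms
    note nE = normed_vector_space_submodule[OF nZ E]
    define C where "C = op_norm (Z\<lparr>carrier := E\<rparr>) X T"
    have C: "0 \<le> C" unfolding C_def by (rule op_norm_nonneg[OF nE T])
    have T_car: "T x \<in> carrier X" and T_add: "y \<in> E \<Longrightarrow> T (x \<oplus>\<^bsub>Z\<^esub> y) = T x \<oplus> T y"
      and T_smult: "T (c \<odot>\<^bsub>Z\<^esub> x) = c \<odot> T x" if "x \<in> E" for x y c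
      using T that unfolding bounded_operator_def by auto
    have T_le: "vnorm X (T x) \<le> C * vnorm Z x" if "x \<in> E" for x
      using bounded_operator_bound[OF nE T, of x] that unfolding C_def by simp
    have "\<exists>g. bounded_functional Z (carrier Z) C g \<and> (\<forall>x\<in>E. g x = \<phi> i (T x))"
      if i: "i \<in> carrier X" for i
    proof -
      have "bounded_functional Z E C (\<lambda>x. \<phi> i (T x))"
        unfolding bounded_functional_def
      proof (intro conjI ballI allI)
        fix x assume x: "x \<in> E"
        show "norm (\<phi> i (T x)) \<le> C * vnorm Z x"
          using \<phi>_le[OF i T_car[OF x] T_car[OF x]] T_le[OF x] by linarith
        show "\<phi> i (T (c \<odot>\<^bsub>Z\<^esub> x)) = c * \<phi> i (T x)" for c
          using T_smult[OF x] \<phi>_smult[OF i T_car[OF x] T_car[OF x]] by simp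
        fix y assume y: "y \<in> E"
        show "\<phi> i (T (x \<oplus>\<^bsub>Z\<^esub> y)) = \<phi> i (T x) + \<phi> i (T y)"
          using T_add[OF x y] \<phi>_add[OF i T_car[OF x] T_car[OF y]] by simp
      qed
      with hbZ[OF nZ] E C show ?thesis unfolding hahn_banach_def by blast
    qed
    then obtain F where F: "\<And>i. i \<in> carrier X \<Longrightarrow> bounded_functional Z (carrier Z) C (F i)"
      "\<And>i x. i \<in> carrier X \<Longrightarrow> x \<in> E \<Longrightarrow> F i x = \<phi> i (T x)" by metis
    define S where "S z i = (if i \<in> carrier X then F i z else 0)" for z i
    have S_bd: "norm (S z i) \<le> C * vnorm Z z" if "z \<in> carrier Z" for z i
      using F(1)[of i] that C Z.vnorm_nonneg[OF that] unfolding S_def bounded_functional_def by simp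
    have S_car: "bounded (range (S z))" if "z \<in> carrier Z" for z
      using S_bd[OF that] by (auto simp: bounded_iff)
    have S_add: "S (z \<oplus>\<^bsub>Z\<^esub> w) = (\<lambda>i. S z i + S w i)" if "z \<in> carrier Z" "w \<in> carrier Z" for z w
      using F(1) that unfolding S_def bounded_functional_def by (auto simp: fun_eq_iff)
    have S_smult: "S (c \<odot>\<^bsub>Z\<^esub> z) = (\<lambda>i. c * S z i)" if "z \<in> carrier Z" for z c
      using F(1) that unfolding S_def bounded_functional_def by (auto simp: fun_eq_iff)
    have S_E: "S x = J (T x)" if "x \<in> E" for x
      using F(2)[OF _ that] by (auto simp: S_def J_def fun_eq_iff)
    define T' where "T' z = P (S z)" for z
    have T'_le: "vnorm X (T' z) \<le> (lam * C) * vnorm Z z" if z: "z \<in> carrier Z" for z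
    proof -
      have "vnorm X (T' z) \<le> lam * vnorm ?L (S z)" unfolding T'_def by (rule P_le[OF S_car[OF z]])
      also have "\<dots> \<le> lam * (C * vnorm Z z)"
        by (intro mult_left_mono[OF _ lam] vnorm_linf_le S_bd[OF z])
      finally show ?thesis by (simp add: mult.assoc)
    qed
    have "bounded_operator Z X T'" unfolding bounded_operator_def
    proof (intro conjI ballI allI)
      show "T' \<in> carrier Z \<rightarrow> carrier X" unfolding T'_def using P_car S_car by auto
      show "\<exists>C. \<forall>z\<in>carrier Z. vnorm X (T' z) \<le> C * vnorm Z z" using T'_le by blast
      fix z assume z: "z \<in> carrier Z"
      show "T' (c \<odot>\<^bsub>Z\<^esub> z) = c \<odot> T' z" for c
        unfolding T'_def S_smult[OF z] by (rule P_smult[OF S_car[OF z]])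
      fix w assume w: "w \<in> carrier Z"
      show "T' (z \<oplus>\<^bsub>Z\<^esub> w) = T' z \<oplus> T' w"
        unfolding T'_def S_add[OF z w] by (rule P_add[OF S_car[OF z] S_car[OF w]])
    qed
    moreover have "\<forall>x\<in>E. T' x = T x" using S_E PJ T_car by (simp add: T'_def)
    moreover have "op_norm Z X T' \<le> lam * C"
      by (rule op_norm_le[OF nZ mult_nonneg_nonneg[OF lam C] T'_le])
    ultimately show "\<exists>T'. bounded_operator Z X T' \<and> (\<forall>x\<in>E. T' x = T x) \<and>
        op_norm Z X T' \<le> lam * op_norm (Z\<lparr>carrier := E\<rparr>) X T"
      unfolding C_def by blast
  qed
qed

theorem injective_imp_injective_wrt_real:
  fixes X :: "(real, 'x) normed_module"
  assumes "banach_space X" "0 \<le> lam" "injective lam X"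
  shows "injective_wrt TYPE('z) lam X"
  by (rule injective_universal[OF assms hahn_banach_real[OF banach_space.axioms(1)[OF assms(1)]] hahn_banach_real])

theorem injective_imp_injective_wrt_complex:
  fixes X :: "(complex, 'x) normed_module"
  assumes "banach_space X" "0 \<le> lam" "injective lam X"
  shows "injective_wrt TYPE('z) lam X"
  by (rule injective_universal[OF assms hahn_banach_complex[OF banach_space.axioms(1)[OF assms(1)]] hahn_banach_complex])

end

theory Submission
  imports Defs
begin

text \<open>
  Fix a matrix \<open>P\<close> with \<open>d\<close> rows and \<open>N\<close> columns, a number \<open>a > 0\<close>, and \<open>N\<close> functionals
  \<open>theta u\<close> on \<open>\<ell>\<^sub>\<infinity>\<close>, and renorm \<open>\<ell>\<^sub>\<infinity>\<close> by
  \<open>max (\<parallel>x\<parallel>\<^sub>\<infinity>) (a * max\<^sub>i \<bar>\<Sum>\<^sub>u P i u * theta u x\<bar>)\<close>.  The functionals vanish on sequences of finite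
  support and have norm one, but they do not attain it; this last property is what separates
  \<open>lam\<close>-injective from \<open>(lam + \<epsilon>)\<close>-injective for every \<open>\<epsilon>\<close>.

  The renormed space sits isometrically in \<open>\<ell>\<^sub>\<infinity>\<close> of a larger index set as a graph, so it is
  \<open>mu\<close>-injective iff there is a linear retraction of norm at most \<open>mu\<close> onto that graph
  (\<open>injective_wrt_of_retraction\<close>, \<open>retraction_of_injective_wrt\<close>).  On the pairs of a sequence and a vector
  of length \<open>d\<close>, a retraction is determined by \<open>d\<close> vectors \<open>y i\<close>, and the infimum of the norms of
  retractions with given numbers \<open>theta u (y i) = C u i\<close> is a function of the \<open>N \<times> d\<close> matrix \<open>C\<close>.
  Two families of inequalities arise: \<open>lift_cost \<le> mu - 1\<close>, which
  controls the sequence coordinates, and \<open>quot_cost \<le> mu\<close>, which controls the \<open>d\<close> additional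
  coordinates.  Let \<open>threshold a\<close> be the infimum of the \<open>mu\<close> for which both can be satisfied.

  Every \<open>mu\<close> above the threshold is an injectivity constant (\<open>injective_above_feasible\<close>).  If the
  threshold itself, assumed to be larger than 1, were one, then a retraction of that norm would
  exist, and because \<open>theta j\<close> does not attain its norm the first family would hold with
  \<^emph>\<open>strict\<close> inequality (\<open>injective_gives_matrix\<close>).  The slack can be spent on moving
  \<open>C\<close> a little towards a right inverse of \<open>P\<close>, whose \<open>quot_cost\<close> is 1; this makes the second family
  strict as well and contradicts the minimality of the threshold (\<open>threshold_improves\<close>).  Hence the
  renormed space is \<open>(lam\<^sup>+)\<close>-injective and not \<open>lam\<close>-injective for \<open>lam = threshold a\<close>.

  It remains to realise every \<open>lam > 1\<close> as a threshold (\<open>threshold_attains\<close>).  The threshold is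
  continuous in \<open>a\<close> and at most 1 for small \<open>a\<close>.  For \<open>P = (I, H / \<surd>n)\<close> with a Hadamard matrix \<open>H\<close> of
  order \<open>n\<close>, a trace argument shows that it exceeds any prescribed bound once \<open>n\<close> and \<open>a\<close> are large,
  so that the intermediate value theorem applies.
\<close>

section \<open>Injectivity and retractions of bounded functions\<close>

text \<open>
  Operators into the bounded functions extend without increase of the norm, by Hahn--Banach in each
  coordinate; composing such an extension with a left inverse \<open>R\<close> of \<open>J\<close> brings it back to \<open>X\<close>.
\<close>

lemma injective_wrt_of_retraction:
  fixes X :: "('k::real_normed_field, 'x) normed_module" and J :: "'x \<Rightarrow> 'i \<Rightarrow> 'k"
  assumes hb: "\<And>Z :: ('k, 'z) normed_module. normed_vector_space Z \<Longrightarrow> hahn_banach Z"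
    and J: "bounded_operator X linf J"
    and J_le: "\<And>x. x \<in> carrier X \<Longrightarrow> vnorm linf (J x) \<le> vnorm X x"
    and R: "bounded_operator linf X R"
    and R_le: "\<And>w. bounded (range w) \<Longrightarrow> vnorm X (R w) \<le> mu * vnorm linf w"
    and RJ: "\<And>x. x \<in> carrier X \<Longrightarrow> R (J x) = x"
    and mu: "0 \<le> mu"
  shows "injective_wrt TYPE('z) mu X"
  unfolding injective_wrt_def
proof (intro allI impI)
  fix Z :: "('k, 'z) normed_module" and E T
  assume Z: "banach_space Z" and E: "submodule E scalar_field Z"
    and T: "bounded_operator (Z\<lparr>carrier := E\<rparr>) X T"
  interpret Z: banach_space Z by fact
  note nZ = Z.normed_vector_space_axioms
  note nE = normed_vector_space_submodule[OF nZ E]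
  define C where "C = op_norm (Z\<lparr>carrier := E\<rparr>) X T"
  have C: "0 \<le> C" unfolding C_def by (rule op_norm_nonneg[OF nE T])
  have T_car: "T x \<in> carrier X" and T_add: "y \<in> E \<Longrightarrow> T (x \<oplus>\<^bsub>Z\<^esub> y) = T x \<oplus>\<^bsub>X\<^esub> T y"
    and T_smult: "T (c \<odot>\<^bsub>Z\<^esub> x) = c \<odot>\<^bsub>X\<^esub> T x" if "x \<in> E" for x y c
    using T that unfolding bounded_operator_def by auto
  have T_le: "vnorm X (T x) \<le> C * vnorm Z x" if "x \<in> E" for x
    using bounded_operator_bound[OF nE T, of x] that unfolding C_def by simp
  have J_car: "bounded (range (J x))" and J_add: "y \<in> carrier X \<Longrightarrow> J (x \<oplus>\<^bsub>X\<^esub> y) = (\<lambda>i. J x i + J y i)"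
    and J_smult: "J (c \<odot>\<^bsub>X\<^esub> x) = (\<lambda>i. c * J x i)" if "x \<in> carrier X" for x y c
    using J that unfolding bounded_operator_def by auto
  have "\<exists>g. bounded_functional Z (carrier Z) C g \<and> (\<forall>x\<in>E. g x = J (T x) i)" for i
  proof -
    have "bounded_functional Z E C (\<lambda>x. J (T x) i)"
      unfolding bounded_functional_def
    proof (intro conjI ballI allI)
      fix x assume x: "x \<in> E"
      show "norm (J (T x) i) \<le> C * vnorm Z x"
        using vnorm_linf_ge[OF J_car[OF T_car[OF x]], of i] J_le[OF T_car[OF x]] T_le[OF x] by linarith
      show "J (T (c \<odot>\<^bsub>Z\<^esub> x)) i = c * J (T x) i" for c
        using T_smult[OF x] J_smult[OF T_car[OF x]] by simp
      fix y assume y: "y \<in> E"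
      show "J (T (x \<oplus>\<^bsub>Z\<^esub> y)) i = J (T x) i + J (T y) i"
        using T_add[OF x y] J_add[OF T_car[OF x] T_car[OF y]] by simp
    qed
    with hb[OF nZ] E C show ?thesis unfolding hahn_banach_def by blast
  qed
  then obtain F where F: "\<And>i. bounded_functional Z (carrier Z) C (F i)"
    "\<And>i x. x \<in> E \<Longrightarrow> F i x = J (T x) i" by metis
  define S where "S z i = F i z" for z i
  have S_bd: "norm (S z i) \<le> C * vnorm Z z" if "z \<in> carrier Z" for z i
    using F(1)[of i] that unfolding S_def bounded_functional_def by simp
  have S_car: "bounded (range (S z))" if "z \<in> carrier Z" for z
    using S_bd[OF that] by (auto simp: bounded_iff)
  have S_add: "S (z \<oplus>\<^bsub>Z\<^esub> w) = (\<lambda>i. S z i + S w i)" if "z \<in> carrier Z" "w \<in> carrier Z" for z w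
    using F(1) that unfolding S_def bounded_functional_def by (auto simp: fun_eq_iff)
  have S_smult: "S (c \<odot>\<^bsub>Z\<^esub> z) = (\<lambda>i. c * S z i)" if "z \<in> carrier Z" for z c
    using F(1) that unfolding S_def bounded_functional_def by (auto simp: fun_eq_iff)
  have S_E: "S x = J (T x)" if "x \<in> E" for x
    using F(2)[OF that] by (auto simp: S_def fun_eq_iff)
  have R_car: "R f \<in> carrier X" and R_add: "bounded (range g) \<Longrightarrow> R (\<lambda>i. f i + g i) = R f \<oplus>\<^bsub>X\<^esub> R g"
    and R_smult: "R (\<lambda>i. c * f i) = c \<odot>\<^bsub>X\<^esub> R f" if "bounded (range f)" for f g c
    using R that unfolding bounded_operator_def by (auto simp: Pi_iff)
  define T' where "T' z = R (S z)" for z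
  have T'_le: "vnorm X (T' z) \<le> (mu * C) * vnorm Z z" if z: "z \<in> carrier Z" for z
  proof -
    have "vnorm X (T' z) \<le> mu * vnorm linf (S z)" unfolding T'_def by (rule R_le[OF S_car[OF z]])
    also have "\<dots> \<le> mu * (C * vnorm Z z)"
      by (intro mult_left_mono[OF _ mu] vnorm_linf_le S_bd[OF z])
    finally show ?thesis by (simp add: mult.assoc)
  qed
  have "bounded_operator Z X T'" unfolding bounded_operator_def
  proof (intro conjI ballI allI)
    show "T' \<in> carrier Z \<rightarrow> carrier X" unfolding T'_def using R_car S_car by auto
    show "\<exists>C. \<forall>z\<in>carrier Z. vnorm X (T' z) \<le> C * vnorm Z z" using T'_le by blast
    fix z assume z: "z \<in> carrier Z"
    show "T' (c \<odot>\<^bsub>Z\<^esub> z) = c \<odot>\<^bsub>X\<^esub> T' z" for c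
      unfolding T'_def S_smult[OF z] by (rule R_smult[OF S_car[OF z]])
    fix w assume w: "w \<in> carrier Z"
    show "T' (z \<oplus>\<^bsub>Z\<^esub> w) = T' z \<oplus>\<^bsub>X\<^esub> T' w"
      unfolding T'_def S_add[OF z w] by (rule R_add[OF S_car[OF z] S_car[OF w]])
  qed
  moreover have "\<forall>x\<in>E. T' x = T x" using S_E RJ T_car by (simp add: T'_def)
  moreover have "op_norm Z X T' \<le> mu * C"
    by (rule op_norm_le[OF nZ mult_nonneg_nonneg[OF mu C] T'_le])
  ultimately show "\<exists>T'. bounded_operator Z X T' \<and> (\<forall>x\<in>E. T' x = T x) \<and>
      op_norm Z X T' \<le> mu * op_norm (Z\<lparr>carrier := E\<rparr>) X T"
    unfolding C_def by blast
qed

text \<open>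
  The retraction is an extension of the inverse of the isometry \<open>J\<close> from its image.
\<close>

lemma retraction_of_injective_wrt:
  fixes X :: "('k::{real_normed_field, banach}, 'x) normed_module" and J :: "'x \<Rightarrow> 'i \<Rightarrow> 'k"
  assumes X: "normed_vector_space X"
    and J: "bounded_operator X linf J"
    and J_norm: "\<And>x. x \<in> carrier X \<Longrightarrow> vnorm linf (J x) = vnorm X x"
    and inj: "injective_wrt TYPE('i \<Rightarrow> 'k) mu X"
    and mu: "0 \<le> mu"
  obtains R where "bounded_operator linf X R"
    and "\<And>w. bounded (range w) \<Longrightarrow> vnorm X (R w) \<le> mu * vnorm linf w"
    and "\<And>x. x \<in> carrier X \<Longrightarrow> R (J x) = x"
proof -
  interpret X: normed_vector_space X by fact
  let ?L = "linf :: ('k, 'i \<Rightarrow> 'k) normed_module"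
  interpret L: normed_vector_space ?L by (rule normed_vector_space_linf)
  have J_car: "bounded (range (J x))" and J_add: "y \<in> carrier X \<Longrightarrow> (\<lambda>i. J x i + J y i) = J (x \<oplus>\<^bsub>X\<^esub> y)"
    and J_smult: "(\<lambda>i. c * J x i) = J (c \<odot>\<^bsub>X\<^esub> x)" if "x \<in> carrier X" for x y c
    using J that unfolding bounded_operator_def by auto
  have sX: "c \<odot>\<^bsub>X\<^esub> x \<in> carrier X" if "x \<in> carrier X" for c x using that X.smult_closed by simp
  define E where "E = J ` carrier X"
  have E: "submodule E scalar_field ?L"
  proof (rule L.submoduleI)
    show "E \<subseteq> carrier ?L" using J_car by (auto simp: E_def)
    show add: "f \<oplus>\<^bsub>?L\<^esub> g \<in> E" if "f \<in> E" "g \<in> E" for f g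
      using that J_add by (auto simp: E_def)
    show sm: "c \<odot>\<^bsub>?L\<^esub> f \<in> E" if "f \<in> E" for c f
      using that J_smult sX by (auto simp: E_def)
    have "J \<zero>\<^bsub>X\<^esub> \<in> E" by (simp add: E_def)
    from sm[OF this, of 0] show "\<zero>\<^bsub>?L\<^esub> \<in> E" by simp
    fix f assume f: "f \<in> E"
    then have "f \<in> carrier ?L" using J_car by (auto simp: E_def)
    then show "\<ominus>\<^bsub>?L\<^esub> f \<in> E" using sm[OF f, of "-1"] L.smult_neg_one[of f] by metis
  qed
  have J_inj: "x = y" if "x \<in> carrier X" "y \<in> carrier X" "J x = J y" for x y
  proof -
    have "J (x \<oplus>\<^bsub>X\<^esub> (-1) \<odot>\<^bsub>X\<^esub> y) = (\<lambda>i. J x i + (-1) * J y i)"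
      using J_add[OF that(1) sX[OF that(2)], of "-1"] J_smult[OF that(2), of "-1"] by metis
    then have "vnorm ?L (J (x \<oplus>\<^bsub>X\<^esub> (-1) \<odot>\<^bsub>X\<^esub> y)) = 0" using that(3) by (simp add: vnorm_linf)
    then have "x \<oplus>\<^bsub>X\<^esub> (-1) \<odot>\<^bsub>X\<^esub> y = \<zero>\<^bsub>X\<^esub>"
      using J_norm[of "x \<oplus>\<^bsub>X\<^esub> (-1) \<odot>\<^bsub>X\<^esub> y"] X.vnorm_eq_0_iff[of "x \<oplus>\<^bsub>X\<^esub> (-1) \<odot>\<^bsub>X\<^esub> y"] that sX[of y "-1"]
      by simp
    then have "x \<oplus>\<^bsub>X\<^esub> \<ominus>\<^bsub>X\<^esub> y = \<zero>\<^bsub>X\<^esub>" using X.smult_neg_one[OF that(2)] by simp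
    then have "\<ominus>\<^bsub>X\<^esub> (\<ominus>\<^bsub>X\<^esub> y) = x" using that by (intro X.minus_equality) auto
    then show ?thesis using that by simp
  qed
  define T where "T = the_inv_into (carrier X) J"
  have T: "T (J x) = x" if "x \<in> carrier X" for x
    unfolding T_def by (rule the_inv_into_f_f[OF inj_onI that]) (use J_inj in auto)
  have T_bd: "vnorm X (T f) \<le> 1 * vnorm (?L\<lparr>carrier := E\<rparr>) f" if "f \<in> E" for f
    using that T J_norm by (auto simp: E_def)
  have T_op: "bounded_operator (?L\<lparr>carrier := E\<rparr>) X T"
    unfolding bounded_operator_def
  proof (intro conjI)
    show "\<exists>C. \<forall>f\<in>carrier (?L\<lparr>carrier := E\<rparr>). vnorm X (T f) \<le> C * vnorm (?L\<lparr>carrier := E\<rparr>) f"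
      using T_bd by (intro exI[of _ 1]) simp
  qed (auto simp: E_def T J_add J_smult sX)
  have nE: "normed_vector_space (?L\<lparr>carrier := E\<rparr>)"
    by (rule normed_vector_space_submodule[OF normed_vector_space_linf E])
  have T_norm: "op_norm (?L\<lparr>carrier := E\<rparr>) X T \<le> 1"
    by (rule op_norm_le[OF nE]) (use T_bd in auto)
  obtain R where R: "bounded_operator ?L X R" "\<And>f. f \<in> E \<Longrightarrow> R f = T f"
    and R_norm: "op_norm ?L X R \<le> mu * op_norm (?L\<lparr>carrier := E\<rparr>) X T"
    using inj banach_space_linf E T_op unfolding injective_wrt_def by blast
  have "mu * op_norm (?L\<lparr>carrier := E\<rparr>) X T \<le> mu * 1"
    by (rule mult_left_mono[OF T_norm mu])
  with R_norm have R_norm: "op_norm ?L X R \<le> mu" by simp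
  have "vnorm X (R f) \<le> mu * vnorm ?L f" if "bounded (range f)" for f
  proof -
    have f: "f \<in> carrier ?L" using that by simp
    have "vnorm X (R f) \<le> op_norm ?L X R * vnorm ?L f"
      by (rule bounded_operator_bound[OF normed_vector_space_linf R(1) f])
    also have "\<dots> \<le> mu * vnorm ?L f"
      by (rule mult_right_mono[OF R_norm L.vnorm_nonneg[OF f]])
    finally show ?thesis .
  qed
  moreover have "R (J x) = x" if "x \<in> carrier X" for x
    using R(2)[of "J x"] T[OF that] that by (simp add: E_def)
  ultimately show ?thesis using that R(1) by blast
qed

section \<open>Functionals that do not attain their norm\<close>

text \<open>
  A Hahn--Banach extension of the limit, from the convergent sequences to all bounded ones.
\<close>

lemma generalised_limit_exists:
  assumes hb: "hahn_banach (linf :: ('k::real_normed_field, nat \<Rightarrow> 'k) normed_module)"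
  obtains L :: "(nat \<Rightarrow> 'k::real_normed_field) \<Rightarrow> 'k"
  where "\<And>f g. bounded (range f) \<Longrightarrow> bounded (range g) \<Longrightarrow> L (\<lambda>n. f n + g n) = L f + L g"
    and "\<And>f c. bounded (range f) \<Longrightarrow> L (\<lambda>n. c * f n) = c * L f"
    and "\<And>f M. (\<And>n. norm (f n) \<le> M) \<Longrightarrow> norm (L f) \<le> M"
    and "\<And>f l. f \<longlonglongrightarrow> l \<Longrightarrow> L f = l"
proof -
  let ?X = "linf :: ('k, nat \<Rightarrow> 'k) normed_module"
  interpret X: normed_vector_space ?X by (rule normed_vector_space_linf)
  define E where "E = {f :: nat \<Rightarrow> 'k. convergent f}"
  have bd: "bounded (range f)" if "convergent f" for f :: "nat \<Rightarrow> 'k"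
    using that by (metis convergent_def convergent_imp_bounded)
  have E: "submodule E scalar_field ?X"
  proof (rule X.submoduleI)
    show "E \<subseteq> carrier ?X" using bd by (auto simp: E_def)
    show "f \<oplus>\<^bsub>?X\<^esub> g \<in> E" if "f \<in> E" "g \<in> E" for f g
      using that by (auto simp: E_def intro: convergent_add)
    show sm: "c \<odot>\<^bsub>?X\<^esub> f \<in> E" if "f \<in> E" for c f
      using that by (auto simp: E_def intro: convergent_mult convergent_const)
    show "\<zero>\<^bsub>?X\<^esub> \<in> E" by (simp add: E_def convergent_const)
    fix f assume f: "f \<in> E"
    then have "f \<in> carrier ?X" using bd by (auto simp: E_def)
    then show "\<ominus>\<^bsub>?X\<^esub> f \<in> E" using sm[OF f, of "-1"] X.smult_neg_one[of f] by metis
  qed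
  have "bounded_functional ?X E 1 lim"
    unfolding bounded_functional_def
  proof (intro conjI ballI allI)
    fix f assume f: "f \<in> E"
    then have lf: "f \<longlonglongrightarrow> lim f" by (simp add: E_def convergent_LIMSEQ_iff)
    show "lim (c \<odot>\<^bsub>?X\<^esub> f) = c * lim f" for c
      using tendsto_mult_left[OF lf, of c] by (simp add: limI)
    have "norm (lim f) \<le> vnorm ?X f"
      by (rule Lim_norm_ubound[OF _ lf]) (use bd[of f] f vnorm_linf_ge[of f] in \<open>auto simp: E_def intro!: always_eventually\<close>)
    then show "norm (lim f) \<le> 1 * vnorm ?X f" by simp
    fix g assume g: "g \<in> E"
    then have lg: "g \<longlonglongrightarrow> lim g" by (simp add: E_def convergent_LIMSEQ_iff)
    show "lim (f \<oplus>\<^bsub>?X\<^esub> g) = lim f + lim g"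
      using tendsto_add[OF lf lg] by (simp add: limI)
  qed
  then obtain L where L: "bounded_functional ?X (carrier ?X) 1 L" "\<forall>f\<in>E. L f = lim f"
    using hb E unfolding hahn_banach_def by (metis zero_le_one)
  show ?thesis
  proof (rule that)
    show "L (\<lambda>n. f n + g n) = L f + L g" if "bounded (range f)" "bounded (range g)" for f g
      using L(1) that unfolding bounded_functional_def by simp
    show "L (\<lambda>n. c * f n) = c * L f" if "bounded (range f)" for f c
      using L(1) that unfolding bounded_functional_def by simp
    show "norm (L f) \<le> M" if "\<And>n. norm (f n) \<le> M" for f M
    proof -
      have "bounded (range f)" using that by (auto simp: bounded_iff)
      then have "norm (L f) \<le> vnorm ?X f" using L(1) unfolding bounded_functional_def by simp
      also have "\<dots> \<le> M" by (rule vnorm_linf_le[OF that])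
      finally show ?thesis .
    qed
    show "L f = l" if "f \<longlonglongrightarrow> l" for f l
      using L(2) that unfolding E_def by (auto simp: convergent_def limI)
  qed
qed

text \<open>
  The clause \<open>theta_less\<close> says at once that each functional has norm at most one and that the norm is
  not attained.  By \<open>theta_lift\<close> the functionals are nevertheless of norm one, even jointly: the
  disjoint supports make the span of \<open>z 0, z 1, \<dots>\<close> a copy, up to the factor \<open>1 + \<epsilon>\<close>, of the finitely
  supported sequences with the supremum norm.  By \<open>theta_upd\<close> they do not see single coordinates.
\<close>

locale nonattaining_family =
  fixes theta :: "nat \<Rightarrow> (nat \<Rightarrow> 'k::real_normed_field) \<Rightarrow> 'k"
  assumes theta_add: "bounded (range x) \<Longrightarrow> bounded (range y) \<Longrightarrow>
      theta u (\<lambda>t. x t + y t) = theta u x + theta u y"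
    and theta_smult: "bounded (range x) \<Longrightarrow> theta u (\<lambda>t. c * x t) = c * theta u x"
    and theta_less: "0 < M \<Longrightarrow> (\<And>t. norm (x t) \<le> M) \<Longrightarrow> norm (theta u x) < M"
    and theta_upd: "bounded (range x) \<Longrightarrow> theta u (x(t := c)) = theta u x"
    and theta_lift: "0 < \<epsilon> \<Longrightarrow> \<exists>z. (\<forall>j t. norm (z j t) \<le> 1 + \<epsilon>) \<and>
      (\<forall>i j t. z i t \<noteq> 0 \<longrightarrow> z j t \<noteq> 0 \<longrightarrow> i = j) \<and> (\<forall>u j. theta u (z j) = of_bool (u = j))"

text \<open>
  Strict convexity of the norm: two vectors of a ball of radius \<open>M\<close> have distance \<open>2 * M\<close> only if they
  are antipodal.
\<close>

lemma parallelogram_antipodal: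
  fixes q b :: "'a::real_inner"
  assumes "norm q \<le> M" "norm b \<le> M" "2 * M \<le> norm (q - b)"
  shows "q = - b"
proof -
  have M: "0 \<le> M" using assms(1) norm_ge_zero order_trans by blast
  have "(norm (q + b))\<^sup>2 + (norm (q - b))\<^sup>2 = 2 * (norm q)\<^sup>2 + 2 * (norm b)\<^sup>2"
    by (simp add: power2_norm_eq_inner inner_add_left inner_add_right inner_diff_left inner_diff_right)
  moreover have "(norm q)\<^sup>2 \<le> M\<^sup>2" "(norm b)\<^sup>2 \<le> M\<^sup>2"
    using assms M by (auto intro: power_mono)
  moreover have "4 * M\<^sup>2 \<le> (norm (q - b))\<^sup>2"
    using power_mono[OF assms(3), of 2] M by (simp add: power_mult_distrib)
  ultimately have "(norm (q + b))\<^sup>2 \<le> 0" by linarith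
  then show ?thesis by (simp add: eq_neg_iff_add_eq_0)
qed

text \<open>
  Read a sequence as an array \<open>x (u, k, m)\<close> and put \<open>q k = L\<^sub>m (x (u, k, m))\<close> with a generalised limit
  \<open>L\<close>.  The functional \<open>theta u x = \<Sum>\<^sub>k 2\<^bsup>-(k+2)\<^esup> * (q k - L q)\<close> has norm at most one.  To attain it, all
  \<open>q k\<close> would have to be antipodal to \<open>L q\<close>; but then \<open>q\<close> is a constant sequence, and its generalised
  limit is that constant and not the antipode.  Taking \<open>q k = 1\<close> for \<open>k < n\<close> and \<open>q k = -1\<close> afterwards
  gives the value \<open>1 - 2\<^bsup>-n\<^esup>\<close>, so the norm is one; the blocks for different \<open>u\<close> are disjoint.
\<close>

lemma nonattaining_family_exists:
  assumes hb: "hahn_banach (linf :: ('k::{real_normed_field, euclidean_space}, nat \<Rightarrow> 'k) normed_module)"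
  shows "\<exists>theta :: nat \<Rightarrow> (nat \<Rightarrow> 'k) \<Rightarrow> 'k. nonattaining_family theta"
proof -
  obtain L :: "(nat \<Rightarrow> 'k) \<Rightarrow> 'k" where L:
    "\<And>f g. bounded (range f) \<Longrightarrow> bounded (range g) \<Longrightarrow> L (\<lambda>n. f n + g n) = L f + L g"
    "\<And>f c. bounded (range f) \<Longrightarrow> L (\<lambda>n. c * f n) = c * L f"
    "\<And>f M. (\<And>n. norm (f n) \<le> M) \<Longrightarrow> norm (L f) \<le> M"
    "\<And>f l. f \<longlonglongrightarrow> l \<Longrightarrow> L f = l"
  proof (rule generalised_limit_exists[OF hb], goal_cases)
    case (1 L)
    show ?case by (rule 1(1)[OF 1(2-5)])
  qed
  define e where "e u k m = prod_encode (u, prod_encode (k, m))" for u k m :: nat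
  define q where "q u x k = L (\<lambda>m. x (e u k m))" for u k and x :: "nat \<Rightarrow> 'k"
  define c :: "nat \<Rightarrow> real" where "c k = (1/2)^(k+2)" for k
  have c_pos: "0 < c k" for k by (simp add: c_def)
  define f where "f u x k = of_real (c k) * (q u x k - L (q u x))" for u k and x :: "nat \<Rightarrow> 'k"
  define theta where "theta u x = (\<Sum>k. f u x k)" for u and x :: "nat \<Rightarrow> 'k"
  have e_eq: "e u k m = e u' k' m' \<longleftrightarrow> u = u' \<and> k = k' \<and> m = m'" for u k m u' k' m'
    by (auto simp: e_def)
  have bd_e: "bounded (range (\<lambda>m. x (e u k m)))" if "bounded (range x)" for u k and x :: "nat \<Rightarrow> 'k"
    using that by (rule bounded_subset) auto
  have q_le: "norm (q u x k) \<le> M" if "\<And>t. norm (x t) \<le> M" for u k M and x :: "nat \<Rightarrow> 'k"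
    unfolding q_def by (rule L(3)) (rule that)
  have q_bd: "bounded (range (q u x))" if "bounded (range x)" for u and x :: "nat \<Rightarrow> 'k"
  proof -
    obtain M where "\<And>t. norm (x t) \<le> M" using \<open>bounded (range x)\<close> by (auto simp: bounded_iff)
    from q_le[where x = x, OF this] show ?thesis by (auto simp: bounded_iff)
  qed
  have geo: "(\<lambda>k. c k * (2 * M)) sums (M::real)" for M
    using sums_mult2[OF sums_mult[OF geometric_sums[of "1/2::real"], of "1/4"], of "2*M"]
    by (simp add: c_def power_add power2_eq_square mult_ac)
  have f_le: "norm (f u x k) \<le> c k * (2 * M)"
    if "\<And>t. norm (x t) \<le> M" for u k M and x :: "nat \<Rightarrow> 'k"
  proof -
    have "norm (q u x k - L (q u x)) \<le> M + M"
      using norm_triangle_ineq4[of "q u x k" "L (q u x)"] q_le[OF that] L(3)[OF q_le[OF that]]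
      by (meson add_mono order_trans)
    then show ?thesis unfolding f_def norm_mult norm_of_real using c_pos[of k] by (intro mult_mono) auto
  qed
  have f_sum: "summable (\<lambda>k. norm (f u x k))" if "bounded (range x)" for u and x :: "nat \<Rightarrow> 'k"
  proof -
    obtain M where "\<And>t. norm (x t) \<le> M" using \<open>bounded (range x)\<close> by (auto simp: bounded_iff)
    from f_le[where x = x, OF this] show ?thesis
      by (intro summable_comparison_test'[OF sums_summable[OF geo[of M]], of 0]) auto
  qed
  note f_sum' = summable_norm_cancel[OF f_sum]
  have "nonattaining_family theta"
  proof
    fix x y :: "nat \<Rightarrow> 'k" and u :: nat assume x: "bounded (range x)" and y: "bounded (range y)"
    have qs: "q u (\<lambda>t. x t + y t) = (\<lambda>k. q u x k + q u y k)"
      unfolding q_def using L(1)[OF bd_e[OF x] bd_e[OF y]] by auto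
    then have "f u (\<lambda>t. x t + y t) = (\<lambda>k. f u x k + f u y k)"
      unfolding f_def qs L(1)[OF q_bd[OF x] q_bd[OF y]] by (simp add: fun_eq_iff algebra_simps)
    then show "theta u (\<lambda>t. x t + y t) = theta u x + theta u y"
      unfolding theta_def using suminf_add[OF f_sum'[OF x] f_sum'[OF y]] by simp
  next
    fix x :: "nat \<Rightarrow> 'k" and u b assume x: "bounded (range x)"
    have qs: "q u (\<lambda>t. b * x t) = (\<lambda>k. b * q u x k)"
      unfolding q_def using L(2)[OF bd_e[OF x]] by auto
    then have "f u (\<lambda>t. b * x t) = (\<lambda>k. b * f u x k)"
      unfolding f_def qs L(2)[OF q_bd[OF x]] by (simp add: fun_eq_iff algebra_simps)
    then show "theta u (\<lambda>t. b * x t) = b * theta u x"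
      unfolding theta_def using suminf_mult[OF f_sum'[OF x]] by simp
  next
    fix x :: "nat \<Rightarrow> 'k" and u and M :: real
    assume M: "0 < M" and xM: "\<And>t. norm (x t) \<le> M"
    have x: "bounded (range x)" using xM by (auto simp: bounded_iff)
    have "\<exists>k. norm (q u x k - L (q u x)) < 2 * M"
    proof (rule ccontr)
      assume "\<nexists>k. norm (q u x k - L (q u x)) < 2 * M"
      then have ge: "2 * M \<le> norm (q u x k - L (q u x))" for k by (meson not_less)
      have "q u x k = - L (q u x)" for k
        by (rule parallelogram_antipodal[OF q_le[OF xM] L(3)[OF q_le[OF xM]] ge])
      then have c: "q u x = (\<lambda>k. - L (q u x))" by auto
      then have "L (q u x) = - L (q u x)" using L(4)[OF tendsto_const] by metis
      then have "L (q u x) = 0" by (metis add.inverse_inverse eq_neg_iff_add_eq_0 mult_2 mult_eq_0_iff zero_neq_numeral)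
      then show False using ge[of 0] M fun_cong[OF c, of 0] by simp
    qed
    then obtain k0 where k0: "norm (q u x k0 - L (q u x)) < 2 * M" ..
    have "0 < (\<Sum>k. c k * (2 * M) - norm (f u x k))"
    proof (rule suminf_pos2)
      show "summable (\<lambda>k. c k * (2 * M) - norm (f u x k))"
        by (rule summable_diff[OF sums_summable[OF geo] f_sum[OF x]])
      show "0 \<le> c k * (2 * M) - norm (f u x k)" for k using f_le[where x = x and u = u and k = k, OF xM] by simp
      have "norm (f u x k0) < c k0 * (2 * M)"
        unfolding f_def norm_mult norm_of_real using k0 c_pos[of k0] by simp
      then show "0 < c k0 * (2 * M) - norm (f u x k0)" by simp
    qed
    also have "\<dots> = M - (\<Sum>k. norm (f u x k))"
      using suminf_diff[OF sums_summable[OF geo[of M]] f_sum[OF x, of u]] sums_unique[OF geo[of M]] by simp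
    finally show "norm (theta u x) < M"
      unfolding theta_def using summable_norm[OF f_sum[OF x, of u]] by linarith
  next
    fix x :: "nat \<Rightarrow> 'k" and u t b assume x: "bounded (range x)"
    have "q u (x(t := b)) k = q u x k" for k
    proof -
      let ?d = "\<lambda>m. (x(t := b)) (e u k m) - x (e u k m)"
      have "(x(t := b)) (e u k m) = x (e u k m)" if "Suc t \<le> m" for m
      proof -
        have "m \<le> e u k m" unfolding e_def using le_prod_encode_2 order_trans by blast
        then show ?thesis using that by auto
      qed
      then have "\<forall>\<^sub>F m in sequentially. ?d m = 0"
        by (intro eventually_sequentiallyI[of "Suc t"]) simp
      then have d: "?d \<longlonglongrightarrow> 0" by (rule tendsto_eventually)
      then have "bounded (range ?d)" by (rule convergent_imp_bounded)
      from L(1)[OF bd_e[OF x, of u k] this] show ?thesis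
        unfolding q_def using L(4)[OF d] by (simp del: fun_upd_apply)
    qed
    then have "q u (x(t := b)) = q u x" by auto
    then show "theta u (x(t := b)) = theta u x" unfolding theta_def f_def by simp
  next
    fix \<epsilon> :: real assume \<epsilon>: "0 < \<epsilon>"
    have "(\<lambda>n. 1 / (1 - (1/2)^n) :: real) \<longlonglongrightarrow> 1 / (1 - 0)"
      by (intro tendsto_intros LIMSEQ_power_zero) auto
    then have "\<forall>\<^sub>F n in sequentially. 1 / (1 - (1/2)^n) < 1 + \<epsilon>"
      using \<epsilon> by (intro order_tendstoD(2)) auto
    then obtain n0 where n0: "\<forall>n\<ge>n0. 1 / (1 - (1/2)^n) < 1 + \<epsilon>"
      unfolding eventually_sequentially by blast
    define n where "n = Suc n0"
    have n: "1 / (1 - (1/2)^n) < 1 + \<epsilon>" "n \<ge> 1"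
      using n0[rule_format, of n] by (simp_all add: n_def)
    define r :: real where "r = 1 - (1/2)^n"
    have r: "r > 0" "1 / r < 1 + \<epsilon>"
      using n power_strict_decreasing[of 0 n "1/2::real"] by (auto simp: r_def)
    define s :: "nat \<Rightarrow> real" where "s k = (if k < n then 1 / r else - (1 / r))" for k
    define z :: "nat \<Rightarrow> nat \<Rightarrow> 'k" where "z j t = (case prod_decode t of (i, t') \<Rightarrow>
      if i = j then of_real (s (fst (prod_decode t'))) else 0)" for j t
    have z_e: "z j (e u k m) = (if u = j then of_real (s k) else 0)" for j u k m
      by (simp add: z_def e_def)
    have "norm (z j t) \<le> 1 + \<epsilon>" for j t
      using r \<epsilon> by (auto simp: z_def s_def split: prod.split)
    moreover have "i = j" if "z i t \<noteq> 0" "z j t \<noteq> 0" for i j t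
      using that by (auto simp: z_def split: prod.splits if_splits)
    moreover have "theta u (z j) = of_bool (u = j)" for u j
    proof (cases "u = j")
      case True
      have q: "q u (z j) = (\<lambda>k. of_real (s k))"
        unfolding q_def z_e using True L(4)[OF tendsto_const] by auto
      have "(\<lambda>k. of_real (s k) :: 'k) \<longlonglongrightarrow> of_real (- (1 / r))"
        by (rule tendsto_eventually, rule eventually_sequentiallyI[of n]) (simp add: s_def)
      then have Lq: "L (q u (z j)) = of_real (- (1 / r))" unfolding q by (rule L(4))
      have f: "f u (z j) k = (if k < n then of_real ((1/2)^(k+1) / r) else 0)" for k
        unfolding f_def Lq unfolding q by (simp add: s_def c_def field_simps)
      have "theta u (z j) = (\<Sum>k<n. f u (z j) k)"
        unfolding theta_def by (rule suminf_finite) (auto simp: f)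
      also have "\<dots> = of_real (\<Sum>k<n. (1/2)^(k+1) / r)" by (simp add: f)
      also have "(\<Sum>k<n. (1/2)^(k+1) / r) = 1"
      proof -
        have "(\<Sum>k<n. (1/2)^(k+1) / r) = (1/2) * (\<Sum>k<n. (1/2)^k) / r"
          by (simp add: sum_distrib_left sum_divide_distrib)
        also have "(\<Sum>k<n. (1/2)^k) = 2 * r"
          by (simp add: sum_gp_strict r_def)
        finally show ?thesis using r by simp
      qed
      finally show ?thesis using True by simp
    next
      case False
      have q: "q u (z j) = (\<lambda>k. 0)"
        unfolding q_def z_e using False L(4)[OF tendsto_const] by auto
      have "f u (z j) = (\<lambda>k. 0)"
        unfolding f_def q using L(4)[OF tendsto_const] by auto
      then show ?thesis unfolding theta_def using False by simp
    qed
    ultimately show "\<exists>z. (\<forall>j t. norm (z j t) \<le> 1 + \<epsilon>) \<and>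
      (\<forall>i j t. z i t \<noteq> 0 \<longrightarrow> z j t \<noteq> 0 \<longrightarrow> i = j) \<and> (\<forall>u j. theta u (z j) = of_bool (u = j))"
      by blast
  qed
  then show ?thesis by blast
qed

section \<open>Costs of matrices\<close>

text \<open>
  In terms of matrices, with absolute row sums, \<open>lift_cost\<close> is row \<open>j\<close> of \<open>\<bar>C\<bar> / a + \<bar>C P\<bar>\<close> and
  \<open>quot_cost\<close> is row \<open>i\<close> of \<open>\<bar>P C\<bar> + a * \<bar>P - P C P\<bar>\<close>.  They are the norms of the two linear forms in
  \<open>(s, g)\<close>, for the supremum norm on \<open>(s, g)\<close>, that occur in \<open>lift_identity\<close> and \<open>quot_identity\<close>.
\<close>

definition lift_cost :: "real \<Rightarrow> nat \<Rightarrow> nat \<Rightarrow> (nat \<Rightarrow> nat \<Rightarrow> 'k::real_normed_field) \<Rightarrow> (nat \<Rightarrow> nat \<Rightarrow> 'k) \<Rightarrow> nat \<Rightarrow> real" where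
  "lift_cost a d N P C j =
     (\<Sum>i<d. norm (C j i)) / a + (\<Sum>u<N. norm (\<Sum>i<d. C j i * P i u))"

definition quot_cost :: "real \<Rightarrow> nat \<Rightarrow> nat \<Rightarrow> (nat \<Rightarrow> nat \<Rightarrow> 'k::real_normed_field) \<Rightarrow> (nat \<Rightarrow> nat \<Rightarrow> 'k) \<Rightarrow> nat \<Rightarrow> real" where
  "quot_cost a d N P C i =
     (\<Sum>k<d. norm (\<Sum>j<N. P i j * C j k)) +
     a * (\<Sum>u<N. norm (P i u - (\<Sum>k<d. (\<Sum>j<N. P i j * C j k) * P k u)))"

definition feasible :: "real \<Rightarrow> nat \<Rightarrow> nat \<Rightarrow> (nat \<Rightarrow> nat \<Rightarrow> 'k::real_normed_field) \<Rightarrow> real set" where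
  "feasible a d N P = {mu. 1 \<le> mu \<and>
     (\<exists>C. (\<forall>j<N. lift_cost a d N P C j \<le> mu - 1) \<and> (\<forall>i<d. quot_cost a d N P C i \<le> mu))}"

text \<open>
  A retraction sends a pair of a sequence \<open>x\<close> and a vector \<open>s\<close> to \<open>x\<close> plus a combination of fixed vectors;
  the coefficients are the residuals, with \<open>g u = theta u x\<close>.  They vanish iff \<open>s = a P g\<close>, that is, on
  the graph.
\<close>

definition residual :: "real \<Rightarrow> nat \<Rightarrow> (nat \<Rightarrow> nat \<Rightarrow> 'k::real_normed_field) \<Rightarrow> (nat \<Rightarrow> 'k) \<Rightarrow> (nat \<Rightarrow> 'k) \<Rightarrow> nat \<Rightarrow> 'k" where
  "residual a N P s g i = s i / of_real a - (\<Sum>u<N. P i u * g u)"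

lemma lift_identity:
  "(\<Sum>i<d. C j i * residual a N P s g i) =
     (\<Sum>i<d. C j i * s i) / of_real a - (\<Sum>u<N. (\<Sum>i<d. C j i * P i u) * g u)"
proof -
  have "(\<Sum>i<d. C j i * (\<Sum>u<N. P i u * g u)) = (\<Sum>u<N. (\<Sum>i<d. C j i * P i u) * g u)"
    by (simp add: sum_distrib_left sum_distrib_right mult.assoc) (rule sum.swap)
  then show ?thesis
    by (simp add: residual_def right_diff_distrib sum_subtractf sum_divide_distrib)
qed

lemma quot_identity:
  assumes "0 < a"
  shows "of_real a * (\<Sum>u<N. P i u * (g u + (\<Sum>k<d. C u k * residual a N P s g k))) =
     (\<Sum>k<d. (\<Sum>j<N. P i j * C j k) * s k) +
     of_real a * (\<Sum>u<N. (P i u - (\<Sum>k<d. (\<Sum>j<N. P i j * C j k) * P k u)) * g u)"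
proof -
  let ?D = "\<lambda>i k. \<Sum>j<N. P i j * C j k"
  have "(\<Sum>u<N. P i u * (\<Sum>k<d. C u k * residual a N P s g k)) = (\<Sum>k<d. ?D i k * residual a N P s g k)"
    by (simp add: sum_distrib_left sum_distrib_right mult.assoc) (rule sum.swap)
  also have "\<dots> = (\<Sum>k<d. ?D i k * s k) / of_real a - (\<Sum>u<N. (\<Sum>k<d. ?D i k * P k u) * g u)"
    by (rule lift_identity[where C = ?D])
  finally have *: "(\<Sum>u<N. P i u * (\<Sum>k<d. C u k * residual a N P s g k)) = \<dots>" .
  show ?thesis
    using assms by (simp add: distrib_left sum.distrib * left_diff_distrib right_diff_distrib sum_subtractf)
qed

lemma norm_sum_mult_le:
  fixes c s :: "nat \<Rightarrow> 'k::real_normed_field"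
  assumes "\<And>i. norm (s i) \<le> M"
  shows "norm (\<Sum>i<n. c i * s i) \<le> (\<Sum>i<n. norm (c i)) * M"
  unfolding sum_distrib_right
  by (rule sum_norm_le) (auto simp: norm_mult intro!: mult_left_mono assms)

lemma aligned_phases:
  fixes c :: "nat \<Rightarrow> 'k::real_normed_field"
  shows "\<exists>s. \<forall>i. norm (s i) \<le> 1 \<and> c i * s i = of_real (norm (c i))"
proof (intro exI allI conjI)
  let ?s = "\<lambda>i. if c i = 0 then 0 else of_real (norm (c i)) / c i"
  show "norm (?s i) \<le> 1" for i by (simp add: norm_divide)
  show "c i * ?s i = of_real (norm (c i))" for i by simp
qed

lemma lift_cost_bound:
  assumes a: "0 < a" and s: "\<And>i. norm (s i) \<le> M" and g: "\<And>u. norm (g u) \<le> M"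
  shows "norm (\<Sum>i<d. C j i * residual a N P s g i) \<le> lift_cost a d N P C j * M"
proof -
  have "norm ((\<Sum>i<d. C j i * s i) / of_real a) \<le> (\<Sum>i<d. norm (C j i)) * M / a"
    using norm_sum_mult_le[OF s, where c = "C j" and n = d] a by (simp add: norm_divide divide_right_mono)
  moreover have "norm (\<Sum>u<N. (\<Sum>i<d. C j i * P i u) * g u) \<le> (\<Sum>u<N. norm (\<Sum>i<d. C j i * P i u)) * M"
    by (rule norm_sum_mult_le[OF g])
  ultimately show ?thesis
    unfolding lift_identity lift_cost_def distrib_right
    using norm_triangle_ineq4 by (smt (verit) times_divide_eq_left)
qed

text \<open>
  The choice of phases makes all terms of the linear form nonnegative, so that the bound
  \<open>lift_cost_bound\<close> is an equality for suitable \<open>s\<close> and \<open>g\<close>.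
\<close>

lemma lift_cost_attained:
  assumes a: "0 < a"
  obtains s g where "\<And>i. norm (s i) \<le> 1" "\<And>u. norm (g u) \<le> 1"
    "(\<Sum>i<d. C j i * residual a N P s g i) = of_real (lift_cost a d N P C j)"
proof -
  obtain s where s: "\<And>i. norm (s i) \<le> 1" "\<And>i. C j i * s i = of_real (norm (C j i))"
    using aligned_phases[of "C j"] by blast
  obtain g where g: "\<And>u. norm (g u) \<le> 1"
      "\<And>u. (\<Sum>i<d. C j i * P i u) * g u = of_real (norm (\<Sum>i<d. C j i * P i u))"
    using aligned_phases[of "\<lambda>u. \<Sum>i<d. C j i * P i u"] by blast
  show ?thesis
  proof (rule that[of s "\<lambda>u. - g u"])
    show "(\<Sum>i<d. C j i * residual a N P s (\<lambda>u. - g u) i) = of_real (lift_cost a d N P C j)"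
      unfolding lift_identity lift_cost_def by (simp add: s g sum_negf)
  qed (use s g in auto)
qed

lemma quot_cost_bound:
  assumes a: "0 < a" and s: "\<And>i. norm (s i) \<le> M" and g: "\<And>u. norm (g u) \<le> M"
  shows "norm (of_real a * (\<Sum>u<N. P i u * (g u + (\<Sum>k<d. C u k * residual a N P s g k))))
    \<le> quot_cost a d N P C i * M"
proof -
  let ?D = "\<lambda>k. \<Sum>j<N. P i j * C j k"
  let ?E = "\<lambda>u. P i u - (\<Sum>k<d. ?D k * P k u)"
  have "norm (\<Sum>k<d. ?D k * s k) \<le> (\<Sum>k<d. norm (?D k)) * M"
    by (rule norm_sum_mult_le[OF s])
  moreover have "norm (of_real a * (\<Sum>u<N. ?E u * g u)) \<le> a * ((\<Sum>u<N. norm (?E u)) * M)"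
    using norm_sum_mult_le[OF g, where c = ?E and n = N] a by (simp add: norm_mult)
  ultimately show ?thesis
    unfolding quot_identity[OF a] quot_cost_def distrib_right
    using norm_triangle_ineq[of "\<Sum>k<d. ?D k * s k" "of_real a * (\<Sum>u<N. ?E u * g u)"] by (simp add: mult.assoc)
qed

lemma quot_cost_attained:
  assumes a: "0 < a"
  obtains s g where "\<And>i. norm (s i) \<le> 1" "\<And>u. norm (g u) \<le> 1"
    "of_real a * (\<Sum>u<N. P i u * (g u + (\<Sum>k<d. C u k * residual a N P s g k))) =
       of_real (quot_cost a d N P C i)"
proof -
  let ?D = "\<lambda>k. \<Sum>j<N. P i j * C j k"
  let ?E = "\<lambda>u. P i u - (\<Sum>k<d. ?D k * P k u)"
  obtain s where s: "\<And>i. norm (s i) \<le> 1" "\<And>i. ?D i * s i = of_real (norm (?D i))"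
    using aligned_phases[of ?D] by blast
  obtain g where g: "\<And>u. norm (g u) \<le> 1" "\<And>u. ?E u * g u = of_real (norm (?E u))"
    using aligned_phases[of ?E] by blast
  show ?thesis
  proof (rule that[OF s(1) g(1)])
    show "of_real a * (\<Sum>u<N. P i u * (g u + (\<Sum>k<d. C u k * residual a N P s g k))) =
       of_real (quot_cost a d N P C i)"
      unfolding quot_identity[OF a] s(2) g(2) quot_cost_def by simp
  qed
qed

text \<open>
  The same matrix \<open>C\<close> serves for both parameters, since every summand of the costs changes at most by
  the factor \<open>r\<close>.  Consequently the logarithm of the threshold is a Lipschitz function of the
  logarithm of \<open>a\<close>.
\<close>

lemma feasible_rescale:
  assumes mu: "mu \<in> feasible a d N P" and a: "0 < a" and b: "0 < b"
    and r: "1 \<le> r" "a \<le> r * b" "b \<le> r * a"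
  shows "r * mu \<in> feasible b d N P"
proof -
  obtain C where C: "\<And>j. j < N \<Longrightarrow> lift_cost a d N P C j \<le> mu - 1"
      "\<And>i. i < d \<Longrightarrow> quot_cost a d N P C i \<le> mu" and mu1: "1 \<le> mu"
    using mu unfolding feasible_def by auto
  have "lift_cost b d N P C j \<le> r * lift_cost a d N P C j" for j
  proof -
    let ?s = "\<Sum>i<d. norm (C j i)" and ?t = "\<Sum>u<N. norm (\<Sum>i<d. C j i * P i u)"
    have st: "0 \<le> ?s" "0 \<le> ?t" by (auto intro: sum_nonneg)
    have "1 / b \<le> r / a" using a b r by (simp add: field_simps)
    then have "?s * (1 / b) \<le> ?s * (r / a)" using st by (intro mult_left_mono) auto
    moreover have "1 * ?t \<le> r * ?t" using r st by (intro mult_right_mono) auto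
    ultimately show ?thesis unfolding lift_cost_def by (simp add: distrib_left mult.commute)
  qed
  moreover have "r * (mu - 1) \<le> r * mu - 1" using r by (simp add: algebra_simps)
  ultimately have "lift_cost b d N P C j \<le> r * mu - 1" if "j < N" for j
    using mult_left_mono[OF C(1)[OF that], of r] r by (smt (verit))
  moreover have "quot_cost b d N P C i \<le> r * quot_cost a d N P C i" for i
  proof -
    let ?s = "\<Sum>k<d. norm (\<Sum>j<N. P i j * C j k)"
    let ?t = "\<Sum>u<N. norm (P i u - (\<Sum>k<d. (\<Sum>j<N. P i j * C j k) * P k u))"
    have st: "0 \<le> ?s" "0 \<le> ?t" by (auto intro: sum_nonneg)
    have "1 * ?s \<le> r * ?s" using r st by (intro mult_right_mono) auto
    moreover have "b * ?t \<le> (r * a) * ?t" using r st by (intro mult_right_mono) auto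
    ultimately show ?thesis unfolding quot_cost_def by (simp add: distrib_left mult.assoc)
  qed
  then have "quot_cost b d N P C i \<le> r * mu" if "i < d" for i
    using mult_left_mono[OF C(2)[OF that], of r] r by (smt (verit))
  moreover have "1 \<le> r * mu" using r mu1 mult_mono[of 1 r 1 mu] by simp
  ultimately show ?thesis unfolding feasible_def by blast
qed

lemma feasible_nonempty: "\<exists>mu. mu \<in> feasible a d N P"
proof -
  define mu where "mu = Max (insert 1 ((\<lambda>i. quot_cost a d N P (\<lambda>_ _. 0) i) ` {..<d}))"
  have "1 \<le> mu" "\<And>i. i < d \<Longrightarrow> quot_cost a d N P (\<lambda>_ _. 0) i \<le> mu"
    unfolding mu_def by (auto intro: Max_ge)
  then have "mu \<in> feasible a d N P"
    unfolding feasible_def by (auto simp: lift_cost_def intro!: exI[of _ "\<lambda>_ _. 0"])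
  then show ?thesis ..
qed

lemma feasible_ge_1: "mu \<in> feasible a d N P \<Longrightarrow> 1 \<le> mu"
  by (simp add: feasible_def)

lemma feasible_mono: "mu \<in> feasible a d N P \<Longrightarrow> mu \<le> mu' \<Longrightarrow> mu' \<in> feasible a d N P"
proof -
  assume mu: "mu \<in> feasible a d N P" and le: "mu \<le> mu'"
  obtain C where "\<forall>j<N. lift_cost a d N P C j \<le> mu - 1" "\<forall>i<d. quot_cost a d N P C i \<le> mu"
    using mu unfolding feasible_def by auto
  then have "\<forall>j<N. lift_cost a d N P C j \<le> mu' - 1" "\<forall>i<d. quot_cost a d N P C i \<le> mu'"
    using le by force+
  moreover have "1 \<le> mu'" using feasible_ge_1[OF mu] le by linarith
  ultimately show ?thesis unfolding feasible_def by auto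
qed

definition threshold :: "nat \<Rightarrow> nat \<Rightarrow> (nat \<Rightarrow> nat \<Rightarrow> 'k::real_normed_field) \<Rightarrow> real \<Rightarrow> real" where
  "threshold d N P a = Inf (feasible a d N P)"

lemma threshold_le: "mu \<in> feasible a d N P \<Longrightarrow> threshold d N P a \<le> mu"
  unfolding threshold_def by (rule cInf_lower) (auto intro: bdd_belowI feasible_ge_1)

lemma le_threshold: "(\<And>mu. mu \<in> feasible a d N P \<Longrightarrow> c \<le> mu) \<Longrightarrow> c \<le> threshold d N P a"
  unfolding threshold_def by (rule cInf_greatest) (use feasible_nonempty[of a d N P] in auto)

lemma feasible_above_threshold:
  assumes "threshold d N P a < mu"
  shows "mu \<in> feasible a d N P"
proof -
  obtain nu where "nu \<in> feasible a d N P" "nu < mu"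
    using le_threshold[of a d N P mu] assms by (meson not_le)
  then show ?thesis using feasible_mono by (metis less_imp_le)
qed

lemma threshold_rescale:
  assumes "0 < a" "0 < b" "1 \<le> r" "a \<le> r * b" "b \<le> r * a"
  shows "threshold d N P b \<le> r * threshold d N P a"
proof -
  have "threshold d N P b / r \<le> threshold d N P a"
    by (rule le_threshold) (use threshold_le[OF feasible_rescale[OF _ assms]] assms(3) in \<open>simp add: field_simps\<close>)
  then show ?thesis using assms(3) by (simp add: field_simps)
qed

lemma threshold_continuous: "continuous_on {0<..} (threshold d N P)"
proof (rule continuous_at_imp_continuous_on, rule ballI)
  fix a :: real assume "a \<in> {0<..}"
  then have a: "0 < a" by simp
  let ?r = "\<lambda>b. max (a / b) (b / a)"
  have r: "(?r \<longlongrightarrow> max (a / a) (a / a)) (at a)"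
    using a by (intro tendsto_intros) auto
  have ev: "\<forall>\<^sub>F b in at a. 0 < b"
    using a by (intro order_tendstoD(1)[OF tendsto_ident_at])
  have le: "threshold d N P b \<le> ?r b * threshold d N P a \<and> threshold d N P a / ?r b \<le> threshold d N P b" if b: "0 < b" for b
  proof -
    have r1: "1 \<le> ?r b" using a b by (cases "a \<le> b") (auto simp: le_max_iff_disj pos_le_divide_eq)
    have "a / b \<le> ?r b" "b / a \<le> ?r b" by auto
    then have "a \<le> ?r b * b" "b \<le> ?r b * a" using a b by (simp_all only: pos_divide_le_eq)
    with r1 have "threshold d N P b \<le> ?r b * threshold d N P a"
        "threshold d N P a \<le> ?r b * threshold d N P b"
      using threshold_rescale a b by blast+
    then show ?thesis using r1 by (simp add: pos_divide_le_eq mult.commute)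
  qed
  have "(threshold d N P \<longlongrightarrow> threshold d N P a) (at a)"
  proof (rule tendsto_sandwich)
    show "\<forall>\<^sub>F b in at a. threshold d N P a / ?r b \<le> threshold d N P b"
      "\<forall>\<^sub>F b in at a. threshold d N P b \<le> ?r b * threshold d N P a"
      using ev by (auto elim!: eventually_mono dest!: le)
    show "((\<lambda>b. threshold d N P a / ?r b) \<longlongrightarrow> threshold d N P a) (at a)"
      using tendsto_divide[OF tendsto_const r, of "threshold d N P a"] a by simp
    show "((\<lambda>b. ?r b * threshold d N P a) \<longlongrightarrow> threshold d N P a) (at a)"
      using tendsto_mult_right[OF r, of "threshold d N P a"] a by simp
  qed
  then show "isCont (threshold d N P) a" by (simp add: isCont_def)
qed

text \<open>
  Both costs are convex in \<open>C\<close>, and the right inverse \<open>R\<close> of \<open>P\<close> has \<open>quot_cost\<close> equal to 1.  On the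
  segment from \<open>C\<close> to \<open>R\<close> the second cost therefore falls below \<open>mu > 1\<close> immediately, while the strict
  inequality for the first cost survives near \<open>C\<close>.
\<close>

lemma threshold_improves:
  assumes a: "0 < a" and mu: "1 < mu"
    and A: "\<And>j. j < N \<Longrightarrow> lift_cost a d N P C j < mu - 1"
    and B: "\<And>i. i < d \<Longrightarrow> quot_cost a d N P C i \<le> mu"
    and R: "\<And>i k. i < d \<Longrightarrow> k < d \<Longrightarrow> (\<Sum>j<N. P i j * R j k) = of_bool (i = k)"
  shows "threshold d N P a < mu"
proof -
  define alpha where "alpha = Max (insert 0 (lift_cost a d N P C ` {..<N}))"
  define beta where "beta = Max (insert 0 (lift_cost a d N P R ` {..<N}))"
  have alpha: "alpha < mu - 1" "\<And>j. j < N \<Longrightarrow> lift_cost a d N P C j \<le> alpha" "0 \<le> alpha"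
    unfolding alpha_def using A mu by (auto intro: Max_ge)
  have beta: "\<And>j. j < N \<Longrightarrow> lift_cost a d N P R j \<le> beta" "0 \<le> beta"
    unfolding beta_def by (auto intro: Max_ge)
  \<comment> \<open>small enough that moving the fraction \<open>t\<close> towards \<open>R\<close> uses at most half of the slack \<open>mu - 1 - alpha\<close>\<close>
  define t where "t = min 1 ((mu - 1 - alpha) / (2 * (beta + 1)))"
  have t: "0 < t" "t \<le> 1" "t * beta < mu - 1 - alpha"
  proof -
    show "0 < t" "t \<le> 1" unfolding t_def using alpha beta by auto
    have "t * beta \<le> (mu - 1 - alpha) / (2 * (beta + 1)) * beta"
      unfolding t_def using beta by (intro mult_right_mono) auto
    also have "\<dots> = (mu - 1 - alpha) * (beta / (2 * (beta + 1)))" by simp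
    also have "\<dots> < (mu - 1 - alpha) * 1"
      using alpha beta by (intro mult_strict_left_mono) auto
    also have "\<dots> = mu - 1 - alpha" by simp
    finally show "t * beta < mu - 1 - alpha" .
  qed
  define K where "K j i = of_real (1 - t) * C j i + of_real t * R j i" for j i
  have tri: "norm (of_real (1 - t) * x + of_real t * y) \<le> (1 - t) * norm x + t * norm y" for x y :: 'a
    using norm_triangle_ineq[of "of_real (1 - t) * x" "of_real t * y"] t by (simp add: norm_mult del: of_real_diff)
  have sum_tri: "(\<Sum>i<n. norm (z i)) \<le> (1 - t) * (\<Sum>i<n. norm (x i)) + t * (\<Sum>i<n. norm (y i))"
    if "\<And>i. i < n \<Longrightarrow> z i = of_real (1 - t) * x i + of_real t * y i" for n and x y z :: "nat \<Rightarrow> 'a"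
    unfolding sum_distrib_left sum.distrib[symmetric] by (rule sum_mono) (use that tri in auto)
  have lin: "(\<Sum>i\<in>S. (of_real (1 - t) * x i + of_real t * y i) * z i)
      = of_real (1 - t) * (\<Sum>i\<in>S. x i * z i) + of_real t * (\<Sum>i\<in>S. y i * z i)"
    for S and x y z :: "nat \<Rightarrow> 'a"
    by (simp add: sum_distrib_left sum.distrib distrib_right mult.assoc)
  have "lift_cost a d N P K j \<le> (1 - t) * lift_cost a d N P C j + t * lift_cost a d N P R j" for j
  proof -
    have "(\<Sum>i<d. norm (K j i)) \<le> (1 - t) * (\<Sum>i<d. norm (C j i)) + t * (\<Sum>i<d. norm (R j i))"
      by (rule sum_tri) (simp add: K_def)
    then have "(\<Sum>i<d. norm (K j i)) / a \<le> (1 - t) * ((\<Sum>i<d. norm (C j i)) / a) + t * ((\<Sum>i<d. norm (R j i)) / a)"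
      using divide_right_mono[of _ _ a] a by (fastforce simp: add_divide_distrib)
    moreover have "(\<Sum>u<N. norm (\<Sum>i<d. K j i * P i u)) \<le>
        (1 - t) * (\<Sum>u<N. norm (\<Sum>i<d. C j i * P i u)) + t * (\<Sum>u<N. norm (\<Sum>i<d. R j i * P i u))"
      by (rule sum_tri) (simp only: K_def lin)
    ultimately show ?thesis unfolding lift_cost_def distrib_left by linarith
  qed
  then have KA: "lift_cost a d N P K j \<le> (1 - t) * alpha + t * beta" if "j < N" for j
    using mult_left_mono[OF alpha(2)[OF that], of "1 - t"] mult_left_mono[OF beta(1)[OF that], of t] t
    by (smt (verit))
  have PK: "(\<Sum>j<N. P i j * K j k) = of_real (1 - t) * (\<Sum>j<N. P i j * C j k) + of_real t * of_bool (i = k)"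
    if "i < d" "k < d" for i k
    unfolding R[OF that, symmetric] K_def
    using lin[of "\<lambda>j. C j k" "\<lambda>j. R j k" "\<lambda>j. P i j" "{..<N}"] by (simp only: mult.commute)
  have KB: "quot_cost a d N P K i \<le> (1 - t) * mu + t" if i: "i < d" for i
  proof -
    let ?D = "\<lambda>k. \<Sum>j<N. P i j * C j k"
    have id: "(\<Sum>k<d. of_bool (i = k) * P k u) = P i u" for u
      using i by (simp add: of_bool_def if_distrib[of "\<lambda>x. x * _"] cong: if_cong)
    have one: "(\<Sum>k<d. norm (of_bool (i = k) :: 'a)) = 1"
      using i by (simp add: of_bool_def if_distrib[of norm] cong: if_cong)
    have "(\<Sum>k<d. norm (\<Sum>j<N. P i j * K j k)) \<le> (1 - t) * (\<Sum>k<d. norm (?D k)) + t * (\<Sum>k<d. norm (of_bool (i = k) :: 'a))"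
      by (rule sum_tri) (rule PK[OF i])
    moreover have "(\<Sum>u<N. norm (P i u - (\<Sum>k<d. (\<Sum>j<N. P i j * K j k) * P k u)))
        \<le> (1 - t) * (\<Sum>u<N. norm (P i u - (\<Sum>k<d. ?D k * P k u))) + t * (\<Sum>u<N. norm (0 :: 'a))"
    proof (rule sum_tri)
      fix u
      have "(\<Sum>k<d. (\<Sum>j<N. P i j * K j k) * P k u)
          = (\<Sum>k<d. (of_real (1 - t) * ?D k + of_real t * of_bool (i = k)) * P k u)"
        by (rule sum.cong) (use PK[OF i] in auto)
      also have "\<dots> = of_real (1 - t) * (\<Sum>k<d. ?D k * P k u) + of_real t * P i u"
        unfolding lin id ..
      finally show "P i u - (\<Sum>k<d. (\<Sum>j<N. P i j * K j k) * P k u)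
          = of_real (1 - t) * (P i u - (\<Sum>k<d. ?D k * P k u)) + of_real t * 0"
        by (simp add: algebra_simps)
    qed
    then have "a * (\<Sum>u<N. norm (P i u - (\<Sum>k<d. (\<Sum>j<N. P i j * K j k) * P k u)))
        \<le> (1 - t) * (a * (\<Sum>u<N. norm (P i u - (\<Sum>k<d. ?D k * P k u))))"
      using mult_left_mono[of _ _ a] a by (fastforce simp: mult.left_commute)
    ultimately have "quot_cost a d N P K i \<le> (1 - t) * quot_cost a d N P C i + t"
      unfolding quot_cost_def distrib_left one by linarith
    then show ?thesis using mult_left_mono[OF B[OF i], of "1 - t"] t by linarith
  qed
  define nu where "nu = max (1 + ((1 - t) * alpha + t * beta)) ((1 - t) * mu + t)"
  have "nu < mu"
  proof -
    have "(1 - t) * alpha \<le> alpha" using t alpha by (simp add: mult_left_le_one_le)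
    then have "1 + ((1 - t) * alpha + t * beta) < mu" using t by linarith
    moreover have "t * 1 < t * mu" using t mu by (intro mult_strict_left_mono) auto
    then have "(1 - t) * mu + t < mu" by (simp add: algebra_simps)
    ultimately show ?thesis by (simp add: nu_def)
  qed
  moreover have "nu \<in> feasible a d N P"
  proof -
    have "1 \<le> nu" unfolding nu_def using t alpha beta by (simp add: le_max_iff_disj)
    moreover have "lift_cost a d N P K j \<le> nu - 1" if "j < N" for j
      using KA[OF that] unfolding nu_def by linarith
    moreover have "quot_cost a d N P K i \<le> nu" if "i < d" for i
      using KB[OF that] unfolding nu_def by linarith
    ultimately show ?thesis unfolding feasible_def by blast
  qed
  ultimately show ?thesis using threshold_le by fastforce
qed

section \<open>Lifting finitely many values of the functionals\<close>

context nonattaining_family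
begin

lemma theta_le:
  assumes "\<And>t. norm (x t) \<le> M"
  shows "norm (theta u x) \<le> M"
proof (rule field_le_epsilon)
  fix e :: real assume e: "0 < e"
  have "0 \<le> M" using norm_ge_zero[of "x 0"] assms[of 0] by linarith
  then have "norm (theta u x) < M + e"
    using e assms by (intro theta_less) (auto intro: add_increasing2)
  then show "norm (theta u x) \<le> M + e" by simp
qed

lemma theta_sum:
  fixes y :: "'b \<Rightarrow> nat \<Rightarrow> 'k"
  assumes "finite A" "bounded (range x)" "\<And>i. i \<in> A \<Longrightarrow> bounded (range (y i))"
  shows "bounded (range (\<lambda>t. x t + (\<Sum>i\<in>A. c i * y i t))) \<and>
    theta u (\<lambda>t. x t + (\<Sum>i\<in>A. c i * y i t)) = theta u x + (\<Sum>i\<in>A. c i * theta u (y i))"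
  using assms(1,3)
proof (induction A rule: finite_induct)
  case empty
  then show ?case using assms(2) by simp
next
  case (insert i A)
  let ?S = "\<lambda>t. x t + (\<Sum>k\<in>A. c k * y k t)"
  have eq: "(\<lambda>t. x t + (\<Sum>k\<in>insert i A. c k * y k t)) = (\<lambda>t. ?S t + c i * y i t)"
    using insert.hyps by (simp add: algebra_simps)
  have y: "bounded (range (y i))" using insert.prems by simp
  have S: "bounded (range ?S)" "theta u ?S = theta u x + (\<Sum>k\<in>A. c k * theta u (y k))"
    using insert by auto
  show ?case
    unfolding eq using bounded_range_add[OF S(1) bounded_range_mult[OF y]]
      theta_add[OF S(1) bounded_range_mult[OF y]] theta_smult[OF y] S(2) insert.hyps
    by (simp add: algebra_simps)
qed

lemma bounded_range_sum:
  fixes y :: "'b \<Rightarrow> nat \<Rightarrow> 'k"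
  assumes "finite A" "\<And>i. i \<in> A \<Longrightarrow> bounded (range (y i))"
  shows "bounded (range (\<lambda>t. \<Sum>i\<in>A. c i * y i t))"
  using theta_sum[where x = "\<lambda>_. 0" and y = y, OF assms(1) _ assms(2)] by simp

lemma theta_sum_0:
  fixes y :: "'b \<Rightarrow> nat \<Rightarrow> 'k"
  assumes "finite A" "\<And>i. i \<in> A \<Longrightarrow> bounded (range (y i))"
  shows "theta u (\<lambda>t. \<Sum>i\<in>A. c i * y i t) = (\<Sum>i\<in>A. c i * theta u (y i))"
proof -
  have "theta u (\<lambda>_. 0) = 0" using theta_le[of "\<lambda>_. 0" 0] by simp
  then show ?thesis using theta_sum[where x = "\<lambda>_. 0" and y = y, OF assms(1) _ assms(2)] by simp
qed

lemma disjoint_lifts: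
  assumes "0 < \<epsilon>"
  obtains z where "\<And>j. bounded (range (z j))" "\<And>u j. theta u (z j) = of_bool (u = j)"
    "\<And>b B N t. 0 \<le> B \<Longrightarrow> (\<And>j. j < N \<Longrightarrow> norm (b j) \<le> B) \<Longrightarrow>
       norm (\<Sum>j<N. b j * z j t) \<le> B * (1 + \<epsilon>)"
proof -
  obtain z where z: "\<And>j t. norm (z j t) \<le> 1 + \<epsilon>"
    and disj: "\<And>i j t. z i t \<noteq> 0 \<Longrightarrow> z j t \<noteq> 0 \<Longrightarrow> i = j"
    and th: "\<And>u j. theta u (z j) = of_bool (u = j)"
    using theta_lift[OF assms] by metis
  show ?thesis
  proof (rule that)
    show "bounded (range (z j))" for j using z by (auto simp: bounded_iff)
    show "theta u (z j) = of_bool (u = j)" for u j by (rule th)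
    fix b :: "nat \<Rightarrow> 'k" and B N t
    assume B: "0 \<le> B" and b: "\<And>j. j < N \<Longrightarrow> norm (b j) \<le> B"
    show "norm (\<Sum>j<N. b j * z j t) \<le> B * (1 + \<epsilon>)"
    proof (cases "\<exists>i<N. z i t \<noteq> 0")
      case True
      then obtain i where i: "i < N" "z i t \<noteq> 0" by blast
      have "(\<Sum>j<N. b j * z j t) = (\<Sum>j\<in>{i}. b j * z j t)"
        by (rule sum.mono_neutral_right) (use i disj in auto)
      then show ?thesis
        using mult_mono[OF b[OF i(1)] z[of i t]] B by (simp add: norm_mult)
    next
      case False
      then have "(\<Sum>j<N. b j * z j t) = 0" by simp
      then show ?thesis using B assms by simp
    qed
  qed
qed

text \<open>
  Together with \<open>theta_le\<close> this says that \<open>x \<mapsto> (theta u x)\<^bsub>u<N\<^esub>\<close> is a quotient map from \<open>\<ell>\<^sub>\<infinity>\<close> onto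
  \<open>\<ell>\<^sub>\<infinity>\<close> of dimension \<open>N\<close>.
\<close>

lemma interpolating_vector:
  assumes "0 < \<epsilon>" "\<And>u. norm (g u) \<le> 1"
  shows "\<exists>x. (\<forall>t. norm (x t) \<le> 1 + \<epsilon>) \<and> (\<forall>u<N. theta u x = g u)"
proof -
  obtain z where z: "\<And>j. bounded (range (z j))" "\<And>u j. theta u (z j) = of_bool (u = j)"
    "\<And>b B N t. 0 \<le> B \<Longrightarrow> (\<And>j. j < N \<Longrightarrow> norm (b j) \<le> B) \<Longrightarrow>
       norm (\<Sum>j<N. b j * z j t) \<le> B * (1 + \<epsilon>)"
    using disjoint_lifts[OF assms(1)] by blast
  show ?thesis
  proof (intro exI[of _ "\<lambda>t. \<Sum>j<N. g j * z j t"] conjI allI impI)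
    show "norm (\<Sum>j<N. g j * z j t) \<le> 1 + \<epsilon>" for t
      using z(3)[of 1 N g t] assms(2) by simp
    show "theta u (\<lambda>t. \<Sum>j<N. g j * z j t) = g u" if "u < N" for u
      using theta_sum_0[where A = "{..<N}" and y = z, OF _ z(1)] that by (simp add: z(2))
  qed
qed

end

section \<open>The renormed space\<close>

text \<open>
  Completeness is inherited because the two norms have the same Cauchy sequences and the same limits.
\<close>

lemma banach_space_equivalent_norm:
  fixes p :: "('i \<Rightarrow> 'k::{real_normed_field, banach}) \<Rightarrow> real"
  assumes p_triangle: "\<And>x y. bounded (range x) \<Longrightarrow> bounded (range y) \<Longrightarrow> p (\<lambda>i. x i + y i) \<le> p x + p y"
    and p_smult: "\<And>c x. bounded (range x) \<Longrightarrow> p (\<lambda>i. c * x i) = norm c * p x"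
    and p_ge: "\<And>x. bounded (range x) \<Longrightarrow> vnorm linf x \<le> p x"
    and p_le: "\<And>x. bounded (range x) \<Longrightarrow> p x \<le> C * vnorm linf x"
  shows "banach_space (linf\<lparr>vnorm := p\<rparr>)"
proof -
  let ?L = "linf :: ('k, 'i \<Rightarrow> 'k) normed_module"
  let ?X = "linf\<lparr>vnorm := p\<rparr>"
  interpret L: normed_vector_space ?L by (rule normed_vector_space_linf)
  have X: "f \<in> carrier ?X \<longleftrightarrow> bounded (range f)" "f \<oplus>\<^bsub>?X\<^esub> g = (\<lambda>i. f i + g i)"
    "\<zero>\<^bsub>?X\<^esub> = (\<lambda>i. 0)" "c \<odot>\<^bsub>?X\<^esub> f = (\<lambda>i. c * f i)" "vnorm ?X f = p f" for f g c
    by (simp_all add: linf_def)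
  have "abelian_group ?X"
  proof (rule abelian_groupI)
    show "\<exists>g\<in>carrier ?X. g \<oplus>\<^bsub>?X\<^esub> f = \<zero>\<^bsub>?X\<^esub>" if "f \<in> carrier ?X" for f
      using that bounded_range_mult[of f "-1"] by (intro bexI[of _ "\<lambda>i. - f i"]) (auto simp: X)
  qed (auto simp: X bounded_range_add algebra_simps)
  then have "Module.module scalar_field ?X"
    by (intro moduleI cring_scalar_field) (auto simp: X bounded_range_mult algebra_simps)
  moreover have "normed_vector_space_axioms ?X"
  proof
    fix f :: "'i \<Rightarrow> 'k" assume "f \<in> carrier ?X"
    then have f: "bounded (range f)" by (simp add: X)
    have "0 \<le> vnorm ?L f" using L.vnorm_nonneg f by simp
    then have "p f = 0 \<longleftrightarrow> vnorm ?L f = 0"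
      using p_ge[OF f] p_le[OF f] by auto
    then show "vnorm ?X f = 0 \<longleftrightarrow> f = \<zero>\<^bsub>?X\<^esub>"
      using L.vnorm_eq_0_iff[of f] f by (simp add: X)
    show "vnorm ?X (c \<odot>\<^bsub>?X\<^esub> f) = norm c * vnorm ?X f" for c
      using p_smult[OF f] by (simp add: X)
    fix g :: "'i \<Rightarrow> 'k" assume "g \<in> carrier ?X"
    then show "vnorm ?X (f \<oplus>\<^bsub>?X\<^esub> g) \<le> vnorm ?X f + vnorm ?X g"
      using p_triangle[OF f] by (simp add: X)
  qed
  ultimately have nX: "normed_vector_space ?X" by (rule normed_vector_space.intro)
  then interpret X: normed_vector_space ?X .
  have minus: "f \<ominus>\<^bsub>?X\<^esub> g = f \<ominus>\<^bsub>?L\<^esub> g" if "bounded (range f)" "bounded (range g)" for f g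
  proof -
    have "bounded (range (\<lambda>i. - g i))" using bounded_range_mult[OF that(2), of "-1"] by simp
    then have "\<ominus>\<^bsub>?X\<^esub> g = (\<lambda>i. - g i)" using that(2) by (intro X.minus_equality) (auto simp: X)
    then show ?thesis using that by (simp add: X.minus_eq X a_minus_linf)
  qed
  have bdd: "bounded (range (f \<ominus>\<^bsub>?L\<^esub> g))" if "bounded (range f)" "bounded (range g)" for f g
    using L.minus_closed[of f g] that by simp
  show ?thesis
  proof (rule banach_space.intro[OF nX], unfold_locales)
    fix s :: "nat \<Rightarrow> 'i \<Rightarrow> 'k"
    assume "\<And>n. s n \<in> carrier ?X"
    then have s: "bounded (range (s n))" for n by (simp add: X)
    assume cau: "\<forall>e>0. \<exists>N. \<forall>m\<ge>N. \<forall>n\<ge>N. vnorm ?X (s m \<ominus>\<^bsub>?X\<^esub> s n) < e"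
    have "vnorm ?L (s m \<ominus>\<^bsub>?L\<^esub> s n) \<le> vnorm ?X (s m \<ominus>\<^bsub>?X\<^esub> s n)" for m n
      using p_ge[OF bdd[OF s s]] by (simp add: minus s X(5))
    with cau have "\<forall>e>0. \<exists>N. \<forall>m\<ge>N. \<forall>n\<ge>N. vnorm ?L (s m \<ominus>\<^bsub>?L\<^esub> s n) < e"
      by (meson le_less_trans)
    then obtain l where l: "l \<in> carrier ?L" "(\<lambda>n. vnorm ?L (s n \<ominus>\<^bsub>?L\<^esub> l)) \<longlonglongrightarrow> 0"
      using banach_space.complete[OF banach_space_linf, of s] s by auto
    then have bl: "bounded (range l)" by simp
    have "(\<lambda>n. vnorm ?X (s n \<ominus>\<^bsub>?X\<^esub> l)) \<longlonglongrightarrow> 0"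
    proof (rule tendsto_sandwich)
      show "\<forall>\<^sub>F n in sequentially. 0 \<le> vnorm ?X (s n \<ominus>\<^bsub>?X\<^esub> l)"
        using X.vnorm_nonneg X.minus_closed s bl by (simp add: X)
      show "\<forall>\<^sub>F n in sequentially. vnorm ?X (s n \<ominus>\<^bsub>?X\<^esub> l) \<le> C * vnorm ?L (s n \<ominus>\<^bsub>?L\<^esub> l)"
        using p_le[OF bdd[OF s bl]] by (simp add: minus s bl X(5))
      show "(\<lambda>n. C * vnorm ?L (s n \<ominus>\<^bsub>?L\<^esub> l)) \<longlonglongrightarrow> 0"
        using tendsto_mult_left[OF l(2), of C] by simp
    qed simp
    then show "\<exists>l\<in>carrier ?X. (\<lambda>n. vnorm ?X (s n \<ominus>\<^bsub>?X\<^esub> l)) \<longlonglongrightarrow> 0"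
      using bl by (intro bexI[of _ l]) (simp_all add: X)
  qed
qed

text \<open>
  The space under study is \<open>\<ell>\<^sub>\<infinity>\<close> with the norm pulled back along \<open>emb\<close>, which maps \<open>x\<close> to itself on the
  left summand of the index set and to the vector \<open>(coord i x)\<^bsub>i<d\<^esub>\<close>, filled up with zeros, on the right
  one.
\<close>

locale renorming = nonattaining_family theta
  for theta :: "nat \<Rightarrow> (nat \<Rightarrow> 'k::{real_normed_field, euclidean_space}) \<Rightarrow> 'k" +
  fixes a :: real and d N :: nat and P :: "nat \<Rightarrow> nat \<Rightarrow> 'k"
  assumes a_pos: "0 < a"
begin

definition coord :: "nat \<Rightarrow> (nat \<Rightarrow> 'k) \<Rightarrow> 'k" where
  "coord i x = of_real a * (\<Sum>u<N. P i u * theta u x)"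

definition emb :: "(nat \<Rightarrow> 'k) \<Rightarrow> nat + nat \<Rightarrow> 'k" where
  "emb x \<gamma> = (case \<gamma> of Inl t \<Rightarrow> x t | Inr i \<Rightarrow> if i < d then coord i x else 0)"

definition space :: "('k, nat \<Rightarrow> 'k) normed_module" where
  "space = linf\<lparr>vnorm := \<lambda>x. vnorm linf (emb x)\<rparr>"

lemma emb_simps [simp]:
  "emb x (Inl t) = x t" "i < d \<Longrightarrow> emb x (Inr i) = coord i x" "\<not> i < d \<Longrightarrow> emb x (Inr i) = 0"
  by (simp_all add: emb_def)

lemma space_simps [simp]:
  "f \<in> carrier space \<longleftrightarrow> bounded (range f)" "f \<oplus>\<^bsub>space\<^esub> g = (\<lambda>i. f i + g i)"
  "c \<odot>\<^bsub>space\<^esub> f = (\<lambda>i. c * f i)" "vnorm space f = vnorm linf (emb f)"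
  by (simp_all add: space_def linf_def)

lemma coord_add: "bounded (range x) \<Longrightarrow> bounded (range y) \<Longrightarrow> coord i (\<lambda>t. x t + y t) = coord i x + coord i y"
  by (simp add: coord_def theta_add distrib_left sum.distrib)

lemma coord_smult: "bounded (range x) \<Longrightarrow> coord i (\<lambda>t. c * x t) = c * coord i x"
  by (simp add: coord_def theta_smult sum_distrib_left mult_ac)

lemma emb_add: "bounded (range x) \<Longrightarrow> bounded (range y) \<Longrightarrow> emb (\<lambda>t. x t + y t) = (\<lambda>\<gamma>. emb x \<gamma> + emb y \<gamma>)"
  by (auto simp: emb_def coord_add fun_eq_iff split: sum.split)

lemma emb_smult: "bounded (range x) \<Longrightarrow> emb (\<lambda>t. c * x t) = (\<lambda>\<gamma>. c * emb x \<gamma>)"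
  by (auto simp: emb_def coord_smult fun_eq_iff split: sum.split)

text \<open>
  An upper bound for the norm of \<open>emb\<close> as an operator on \<open>\<ell>\<^sub>\<infinity>\<close>.
\<close>

definition weight :: real where
  "weight = 1 + a * (\<Sum>i<d. \<Sum>u<N. norm (P i u))"

lemma emb_le:
  assumes x: "\<And>t. norm (x t) \<le> M"
  shows "norm (emb x \<gamma>) \<le> weight * M"
proof -
  have M: "0 \<le> M" using norm_ge_zero[of "x 0"] x[of 0] by linarith
  let ?S = "\<Sum>i<d. \<Sum>u<N. norm (P i u)"
  have S: "0 \<le> a * ?S" using a_pos by (simp add: sum_nonneg)
  have "norm (coord i x) \<le> a * ?S * M" if "i < d" for i
  proof -
    have "norm (\<Sum>u<N. P i u * theta u x) \<le> (\<Sum>u<N. norm (P i u)) * M"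
      by (rule norm_sum_mult_le[OF theta_le[OF x]])
    also have "\<dots> \<le> ?S * M"
      using that M by (intro mult_right_mono member_le_sum) (auto intro: sum_nonneg)
    finally show ?thesis using a_pos by (simp add: coord_def norm_mult mult.assoc)
  qed
  moreover have "1 * M \<le> weight * M" "a * ?S * M \<le> weight * M" "0 \<le> weight * M"
    using S M unfolding weight_def by (intro mult_right_mono mult_nonneg_nonneg; simp)+
  ultimately show ?thesis
    using x by (auto simp: emb_def split: sum.split intro: order_trans)
qed

lemma emb_bounded: "bounded (range x) \<Longrightarrow> bounded (range (emb x))"
proof -
  assume "bounded (range x)"
  then obtain M where "\<And>t. norm (x t) \<le> M" by (auto simp: bounded_iff)
  from emb_le[of x, OF this] show ?thesis by (auto simp: bounded_iff)
qed

lemma banach_space_space: "banach_space space"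
  unfolding space_def
proof (rule banach_space_equivalent_norm[where C = weight])
  interpret L: normed_vector_space "linf :: ('k, nat + nat \<Rightarrow> 'k) normed_module"
    by (rule normed_vector_space_linf)
  fix x :: "nat \<Rightarrow> 'k" assume x: "bounded (range x)"
  show "vnorm linf (emb (\<lambda>i. c * x i)) = norm c * vnorm linf (emb x)" for c
    using L.vnorm_smult[of "emb x" c] emb_bounded[OF x] by (simp add: emb_smult x)
  show "vnorm linf x \<le> vnorm linf (emb x)"
    using vnorm_linf_ge[OF emb_bounded[OF x], of "Inl _"] by (intro vnorm_linf_le) simp
  show "vnorm linf (emb x) \<le> weight * vnorm linf x"
    by (intro vnorm_linf_le emb_le vnorm_linf_ge x)
  fix y :: "nat \<Rightarrow> 'k" assume y: "bounded (range y)"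
  show "vnorm linf (emb (\<lambda>i. x i + y i)) \<le> vnorm linf (emb x) + vnorm linf (emb y)"
    using L.vnorm_triangle[of "emb x" "emb y"] emb_bounded x y by (simp add: emb_add)
qed

lemma bounded_operator_emb: "bounded_operator space linf emb"
  unfolding bounded_operator_def
  by (auto simp: emb_bounded emb_add emb_smult intro: exI[of _ 1])

text \<open>
  A matrix \<open>C\<close> within the cost bounds gives the retraction
  \<open>w \<mapsto> x + \<Sum>\<^sub>i residual i * y i\<close>, where \<open>y i = \<Sum>\<^sub>j C j i * z j\<close> is built from the disjoint lifts.  Only the
  factor \<open>1 + \<epsilon>\<close> in the norm of the lifts is lost, which is why \<open>mu'\<close> has to exceed \<open>mu\<close>.
\<close>

lemma injective_above_feasible:
  assumes hb: "\<And>Z :: ('k, 'z) normed_module. normed_vector_space Z \<Longrightarrow> hahn_banach Z"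
    and mu: "mu \<in> feasible a d N P" and less: "mu < mu'"
  shows "injective_wrt TYPE('z) mu' space"
proof -
  obtain C where C: "\<And>j. j < N \<Longrightarrow> lift_cost a d N P C j \<le> mu - 1"
      "\<And>i. i < d \<Longrightarrow> quot_cost a d N P C i \<le> mu" and mu1: "1 \<le> mu"
    using mu unfolding feasible_def by auto
  \<comment> \<open>the loss \<open>(mu - 1) * \<epsilon>\<close> on the sequence coordinates must not exceed \<open>mu' - mu\<close>\<close>
  define \<epsilon> where "\<epsilon> = (mu' - mu) / mu"
  have \<epsilon>: "0 < \<epsilon>" using mu1 less by (simp add: \<epsilon>_def)
  have slack: "1 + (mu - 1) * (1 + \<epsilon>) \<le> mu'"
  proof -
    have "mu * \<epsilon> = mu' - mu" using mu1 by (simp add: \<epsilon>_def)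
    then show ?thesis using \<epsilon> by (simp add: algebra_simps)
  qed
  obtain z where z: "\<And>j. bounded (range (z j))" "\<And>u j. theta u (z j) = of_bool (u = j)"
    "\<And>b B N t. 0 \<le> B \<Longrightarrow> (\<And>j. j < N \<Longrightarrow> norm (b j) \<le> B) \<Longrightarrow>
       norm (\<Sum>j<N. b j * z j t) \<le> B * (1 + \<epsilon>)"
    using disjoint_lifts[OF \<epsilon>] by blast
  define y where "y i t = (\<Sum>j<N. C j i * z j t)" for i t
  have y_bd: "bounded (range (y i))" for i
    unfolding y_def by (rule bounded_range_sum) (auto intro: z)
  have y_th: "theta u (y i) = C u i" if "u < N" for u i
    using theta_sum_0[where A = "{..<N}" and y = z, OF _ z(1)] that by (simp add: y_def[abs_def] z(2))
  define x where "x w t = w (Inl t)" for w :: "nat + nat \<Rightarrow> 'k" and t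
  define s where "s w i = w (Inr i)" for w :: "nat + nat \<Rightarrow> 'k" and i
  define r where "r w = residual a N P (s w) (\<lambda>u. theta u (x w))" for w
  define R where "R w = (\<lambda>t. x w t + (\<Sum>i<d. r w i * y i t))" for w
  have x_bd: "bounded (range (x w))" if "bounded (range w)" for w
    using that by (rule bounded_subset) (auto simp: x_def)
  have R_bd: "bounded (range (R w))" if "bounded (range w)" for w
    unfolding R_def using theta_sum[where A = "{..<d}" and y = y, OF _ x_bd[OF that] y_bd] by auto
  have R_th: "theta u (R w) = theta u (x w) + (\<Sum>k<d. C u k * r w k)" if "u < N" "bounded (range w)" for u w
    unfolding R_def using theta_sum[where A = "{..<d}" and y = y and c = "r w" and u = u, OF _ x_bd[OF that(2)] y_bd] that
    by (simp add: y_th mult.commute)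
  have R_le: "vnorm space (R w) \<le> mu' * vnorm linf w" if w: "bounded (range w)" for w
  proof -
    define M where "M = vnorm linf w"
    have wM: "norm (w \<gamma>) \<le> M" for \<gamma> unfolding M_def by (rule vnorm_linf_ge[OF w])
    have M: "0 \<le> M" using norm_ge_zero wM order_trans by blast
    have sM: "norm (s w i) \<le> M" for i unfolding s_def by (rule wM)
    have gM: "norm (theta u (x w)) \<le> M" for u by (rule theta_le) (simp add: x_def wM)
    have "norm (emb (R w) \<gamma>) \<le> mu' * M" for \<gamma>
    proof (cases \<gamma>)
      case (Inl t)
      have "(\<Sum>i<d. r w i * y i t) = (\<Sum>j<N. (\<Sum>i<d. C j i * r w i) * z j t)"
        by (simp add: y_def sum_distrib_left sum_distrib_right mult_ac) (rule sum.swap)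
      also have "norm \<dots> \<le> ((mu - 1) * M) * (1 + \<epsilon>)"
      proof (rule z(3))
        show "norm (\<Sum>i<d. C j i * r w i) \<le> (mu - 1) * M" if "j < N" for j
          using lift_cost_bound[where N = N and P = P and j = j and d = d and C = C and s = "s w" and g = "\<lambda>u. theta u (x w)", OF a_pos sM gM] mult_right_mono[OF C(1)[OF that] M]
          unfolding r_def by linarith
      qed (use mu1 M in simp)
      finally have "norm (R w t) \<le> M + ((mu - 1) * M) * (1 + \<epsilon>)"
        unfolding R_def using norm_triangle_ineq[of "x w t"] wM[of "Inl t"] unfolding x_def
        by (smt (verit, best))
      also have "\<dots> = (1 + (mu - 1) * (1 + \<epsilon>)) * M" by (simp add: algebra_simps)
      also have "\<dots> \<le> mu' * M" by (rule mult_right_mono[OF slack M])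
      finally show ?thesis using Inl by simp
    next
      case (Inr i)
      show ?thesis
      proof (cases "i < d")
        case True
        have "coord i (R w) = of_real a * (\<Sum>u<N. P i u * (theta u (x w) + (\<Sum>k<d. C u k * r w k)))"
          unfolding coord_def using R_th[OF _ w] by simp
        then have "norm (coord i (R w)) \<le> quot_cost a d N P C i * M"
          unfolding r_def
            using quot_cost_bound[where N = N and P = P and i = i and d = d and C = C and s = "s w" and g = "\<lambda>u. theta u (x w)", OF a_pos sM gM] by simp
        also have "\<dots> \<le> mu' * M" using C(2)[OF True] less by (intro mult_right_mono M) simp
        finally show ?thesis using Inr True by simp
      next
        case False
        then show ?thesis using Inr M mu1 less by simp
      qed
    qed
    then show ?thesis by (simp add: M_def vnorm_linf_le)
  qed
  have "bounded_operator linf space R"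
    unfolding bounded_operator_def
  proof (intro conjI ballI allI)
    show "R \<in> carrier linf \<rightarrow> carrier space" using R_bd by auto
    show "\<exists>C. \<forall>w\<in>carrier linf. vnorm space (R w) \<le> C * vnorm linf w"
      using R_le by (intro exI[of _ mu'] ballI) simp
    fix w :: "nat + nat \<Rightarrow> 'k" assume "w \<in> carrier linf"
    then have w: "bounded (range w)" by simp
    have "x (\<lambda>i. c * w i) = (\<lambda>t. c * x w t)" for c by (simp add: x_def fun_eq_iff)
    then have "r (\<lambda>i. c * w i) i = c * r w i" for c i
      by (simp add: r_def residual_def s_def theta_smult x_bd[OF w] sum_distrib_left right_diff_distrib mult_ac)
    then show "R (c \<odot>\<^bsub>linf\<^esub> w) = c \<odot>\<^bsub>space\<^esub> R w" for c
      by (simp add: R_def x_def distrib_left sum_distrib_left mult_ac)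
    fix w' :: "nat + nat \<Rightarrow> 'k" assume "w' \<in> carrier linf"
    then have w': "bounded (range w')" by simp
    have "x (\<lambda>i. w i + w' i) = (\<lambda>t. x w t + x w' t)" by (simp add: x_def fun_eq_iff)
    then have "r (\<lambda>i. w i + w' i) i = r w i + r w' i" for i
      by (simp add: r_def residual_def s_def theta_add x_bd[OF w] x_bd[OF w'] sum.distrib
          distrib_left add_divide_distrib)
    then show "R (w \<oplus>\<^bsub>linf\<^esub> w') = R w \<oplus>\<^bsub>space\<^esub> R w'"
      by (simp add: R_def x_def sum.distrib algebra_simps)
  qed
  moreover have "R (emb v) = v" for v
  proof -
    have xv: "x (emb v) = v" by (simp add: x_def fun_eq_iff)
    have "r (emb v) i = 0" if "i < d" for i
      using that a_pos by (simp add: r_def xv residual_def s_def coord_def)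
    then show ?thesis by (simp add: R_def xv)
  qed
  ultimately show ?thesis
    by (intro injective_wrt_of_retraction[where J = emb and R = R] hb bounded_operator_emb R_le)
       (use mu1 less in auto)
qed

text \<open>
  By linearity a retraction is \<open>w \<mapsto> x + \<Sum>\<^sub>i residual i * y i\<close> with \<open>y i\<close> the image of a multiple of a unit
  vector.  The functionals \<open>theta u\<close>, hence the residuals, ignore the value of \<open>x\<close> at a single place
  \<open>t\<close>.  If that value is aligned with the remaining sum \<open>h t\<close>, the two absolute values add up, and
  \<open>1 + \<bar>h t\<bar> \<le> mu\<close> follows.  So \<open>h\<close> has norm at most \<open>mu - 1\<close>, and the strict inequality comes
  from applying the functional \<open>theta j\<close>, which does not attain its norm, to \<open>h\<close>.
\<close>

lemma injective_gives_matrix: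
  assumes inj: "injective_wrt TYPE(nat + nat \<Rightarrow> 'k) mu space" and mu: "1 < mu"
  shows "\<exists>C. (\<forall>j<N. lift_cost a d N P C j < mu - 1) \<and> (\<forall>i<d. quot_cost a d N P C i \<le> mu)"
proof -
  obtain R where R: "bounded_operator linf space R"
    and R_le: "\<And>w. bounded (range w) \<Longrightarrow> vnorm space (R w) \<le> mu * vnorm linf w"
    and R_emb: "\<And>x. bounded (range x) \<Longrightarrow> R (emb x) = x"
    using retraction_of_injective_wrt[OF banach_space.axioms(1)[OF banach_space_space]
        bounded_operator_emb _ inj] mu by auto
  have R_bd: "bounded (range (R w))"
    and R_add: "bounded (range w') \<Longrightarrow> R (\<lambda>\<gamma>. w \<gamma> + w' \<gamma>) = (\<lambda>t. R w t + R w' t)"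
    and R_smult: "R (\<lambda>\<gamma>. c * w \<gamma>) = (\<lambda>t. c * R w t)" if "bounded (range w)" for w w' c
    using R that unfolding bounded_operator_def by (auto simp: Pi_iff)
  define e :: "nat \<Rightarrow> nat + nat \<Rightarrow> 'k" where "e i \<gamma> = of_bool (\<gamma> = Inr i)" for i \<gamma>
  have e_bd: "bounded (range (e i))" for i by (auto simp: bounded_iff e_def intro!: exI[of _ 1])
  have R_sum: "bounded (range (\<lambda>\<gamma>. emb x \<gamma> + (\<Sum>i\<in>A. c i * e i \<gamma>))) \<and>
      R (\<lambda>\<gamma>. emb x \<gamma> + (\<Sum>i\<in>A. c i * e i \<gamma>)) = (\<lambda>t. x t + (\<Sum>i\<in>A. c i * R (e i) t))"
    if "finite A" "bounded (range x)" for A x c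
    using that(1)
  proof (induction A rule: finite_induct)
    case empty
    then show ?case using that(2) by (simp add: R_emb emb_bounded)
  next
    case (insert i A)
    let ?S = "\<lambda>\<gamma>. emb x \<gamma> + (\<Sum>k\<in>A. c k * e k \<gamma>)"
    have eq: "(\<lambda>\<gamma>. emb x \<gamma> + (\<Sum>k\<in>insert i A. c k * e k \<gamma>)) = (\<lambda>\<gamma>. ?S \<gamma> + c i * e i \<gamma>)"
      using insert.hyps by (simp add: algebra_simps)
    have S: "bounded (range ?S)" "R ?S = (\<lambda>t. x t + (\<Sum>k\<in>A. c k * R (e k) t))"
      using insert.IH by auto
    show ?case
      unfolding eq using bounded_range_add[OF S(1) bounded_range_mult[OF e_bd[of i]]]
        R_add[OF S(1) bounded_range_mult[OF e_bd[of i]]] R_smult[OF e_bd[of i]] S(2) insert.hyps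
      by (simp add: algebra_simps)
  qed
  define y where "y i t = of_real a * R (e i) t" for i t
  have y_bd: "bounded (range (y i))" for i
    unfolding y_def by (rule bounded_range_mult[OF R_bd[OF e_bd]])
  define C where "C j i = theta j (y i)" for j i
  define F where "F s x t = x t + (\<Sum>i<d. residual a N P s (\<lambda>u. theta u x) i * y i t)" for s x t
  have F_le: "norm (emb (F s x) \<gamma>) \<le> mu * M"
    if x: "\<And>t. norm (x t) \<le> M" and s: "\<And>i. norm (s i) \<le> M" for s x M \<gamma>
  proof -
    have xb: "bounded (range x)" using x by (auto simp: bounded_iff)
    have M: "0 \<le> M" using x norm_ge_zero order_trans by blast
    let ?w = "\<lambda>\<gamma>. emb x \<gamma> + (\<Sum>i<d. (s i - coord i x) * e i \<gamma>)"
    have w_bd: "bounded (range ?w)"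
      and Rw: "R ?w = (\<lambda>t. x t + (\<Sum>i<d. (s i - coord i x) * R (e i) t))"
      using R_sum[where A = "{..<d}" and c = "\<lambda>i. s i - coord i x", OF finite_lessThan xb] by auto
    have "s i - coord i x = residual a N P s (\<lambda>u. theta u x) i * of_real a" for i
      using a_pos by (simp add: residual_def coord_def field_simps)
    then have RF: "R ?w = F s x" unfolding Rw F_def y_def by (simp add: mult.assoc fun_eq_iff)
    have "norm (?w \<gamma>) \<le> M" for \<gamma>
    proof (cases \<gamma>)
      case (Inr i)
      have "(\<Sum>k<d. (s k - coord k x) * e k (Inr i)) = (if i < d then s i - coord i x else 0)"
        by (simp add: e_def of_bool_def if_distrib[of "\<lambda>v. _ * v"] cong: if_cong)
      then show ?thesis using Inr s M by simp
    qed (use x in \<open>simp add: e_def\<close>)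
    then have "vnorm linf ?w \<le> M" by (rule vnorm_linf_le)
    then have "mu * vnorm linf ?w \<le> mu * M" using mu by (intro mult_left_mono) auto
    then have "vnorm linf (emb (F s x)) \<le> mu * M"
      using R_le[OF w_bd] unfolding RF by simp
    then show ?thesis
      using vnorm_linf_ge[OF emb_bounded[OF R_bd[OF w_bd]], of \<gamma>] unfolding RF by linarith
  qed
  have F_th: "theta u (F s x) = theta u x + (\<Sum>k<d. C u k * residual a N P s (\<lambda>u. theta u x) k)"
    if "bounded (range x)" for u s x
    unfolding F_def C_def
    using theta_sum[where A = "{..<d}" and y = y and c = "residual a N P s (\<lambda>u. theta u x)" and u = u, OF _ that y_bd] by (simp add: mult.commute)
  have res_cong: "residual a N P s g i = residual a N P s g' i" if "\<And>u. u < N \<Longrightarrow> g u = g' u" for s g g' i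
    unfolding residual_def using that by simp
  have "lift_cost a d N P C j < mu - 1" if j: "j < N" for j
  proof -
    obtain s g where s: "\<And>i. norm (s i) \<le> 1" and g: "\<And>u. norm (g u) \<le> 1"
      and eq: "(\<Sum>i<d. C j i * residual a N P s g i) = of_real (lift_cost a d N P C j)"
      using lift_cost_attained[OF a_pos] by blast
    define h where "h t = (\<Sum>i<d. residual a N P s g i * y i t)" for t
    have "norm (h t) \<le> mu - 1" for t
    proof (rule field_le_epsilon)
      fix \<epsilon>' :: real assume "0 < \<epsilon>'"
      define \<epsilon> where "\<epsilon> = \<epsilon>' / mu"
      have \<epsilon>: "0 < \<epsilon>" "mu * \<epsilon> = \<epsilon>'" using \<open>0 < \<epsilon>'\<close> mu by (simp_all add: \<epsilon>_def)
      from interpolating_vector[OF \<epsilon>(1) g, of N]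
      obtain x0 where "(\<forall>t. norm (x0 t) \<le> 1 + \<epsilon>) \<and> (\<forall>u<N. theta u x0 = g u)" ..
      then have x0: "\<And>t. norm (x0 t) \<le> 1 + \<epsilon>" "\<And>u. u < N \<Longrightarrow> theta u x0 = g u"
        by auto
      \<comment> \<open>the phase of \<open>h t\<close>, put at place \<open>t\<close> of the test vector\<close>
      define c where "c = (if h t = 0 then 1 else h t / of_real (norm (h t)))"
      have c: "norm c = 1" "c * of_real (norm (h t)) = h t"
        by (auto simp: c_def norm_divide)
      define x where "x = x0(t := c)"
      have x_le: "norm (x t') \<le> 1 + \<epsilon>" for t' using x0(1) c \<epsilon> by (simp add: x_def)
      have s_le: "norm (s i) \<le> 1 + \<epsilon>" for i using s[of i] \<epsilon>(1) by linarith
      have "bounded (range x0)" using x0(1) by (auto simp: bounded_iff)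
      then have x_th: "theta u x = g u" if "u < N" for u
        unfolding x_def using theta_upd x0(2)[OF that] by simp
      have "F s x t = c + h t"
        unfolding F_def h_def using res_cong[of "\<lambda>u. theta u x" g] x_th by (simp add: x_def)
      also have "\<dots> = c * of_real (1 + norm (h t))" using c(2) by (simp add: distrib_left)
      finally have "norm (F s x t) = 1 + norm (h t)" using c(1) by (simp add: norm_mult del: of_real_add)
      moreover have "norm (F s x t) \<le> mu * (1 + \<epsilon>)"
        using F_le[where \<gamma> = "Inl t", OF x_le s_le] by simp
      ultimately show "norm (h t) \<le> mu - 1 + \<epsilon>'" using \<epsilon>(2) by (simp add: distrib_left)
    qed
    then have "norm (theta j h) < mu - 1" using mu by (intro theta_less) auto
    moreover have "theta j h = of_real (lift_cost a d N P C j)"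
      unfolding eq[symmetric] h_def
      using theta_sum_0[where A = "{..<d}" and y = y and c = "residual a N P s g" and u = j, OF _ y_bd] by (simp add: C_def mult.commute)
    ultimately show ?thesis by simp
  qed
  moreover have "quot_cost a d N P C i \<le> mu" if i: "i < d" for i
  proof (rule field_le_epsilon)
    fix \<epsilon>' :: real assume "0 < \<epsilon>'"
    define \<epsilon> where "\<epsilon> = \<epsilon>' / mu"
    have \<epsilon>: "0 < \<epsilon>" "mu * \<epsilon> = \<epsilon>'" using \<open>0 < \<epsilon>'\<close> mu by (simp_all add: \<epsilon>_def)
    obtain s g where s: "\<And>i. norm (s i) \<le> 1" and g: "\<And>u. norm (g u) \<le> 1"
      and eq: "of_real a * (\<Sum>u<N. P i u * (g u + (\<Sum>k<d. C u k * residual a N P s g k))) =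
       of_real (quot_cost a d N P C i)"
      using quot_cost_attained[OF a_pos] by blast
    from interpolating_vector[OF \<epsilon>(1) g, of N]
    obtain x where "(\<forall>t. norm (x t) \<le> 1 + \<epsilon>) \<and> (\<forall>u<N. theta u x = g u)" ..
    then have x: "\<And>t. norm (x t) \<le> 1 + \<epsilon>" "\<And>u. u < N \<Longrightarrow> theta u x = g u"
      by auto
    have s_le: "norm (s i) \<le> 1 + \<epsilon>" for i using s[of i] \<epsilon>(1) by linarith
    have xb: "bounded (range x)" using x(1) by (auto simp: bounded_iff)
    have "coord i (F s x) = of_real (quot_cost a d N P C i)"
      unfolding coord_def eq[symmetric] F_th[OF xb]
      using res_cong[of "\<lambda>u. theta u x" g] x(2) by simp
    moreover have "norm (coord i (F s x)) \<le> mu * (1 + \<epsilon>)"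
      using F_le[where \<gamma> = "Inr i", OF x(1) s_le] i by simp
    ultimately show "quot_cost a d N P C i \<le> mu + \<epsilon>'" using \<epsilon>(2) by (simp add: distrib_left)
  qed
  ultimately show ?thesis by blast
qed

end

section \<open>Hadamard matrices and the range of the threshold\<close>

text \<open>
  The Hadamard matrices of Sylvester: \<open>walsh (Suc k)\<close> consists of four blocks equal to \<open>walsh k\<close>, the
  last one with the opposite sign.
\<close>

fun walsh :: "nat \<Rightarrow> nat \<Rightarrow> nat \<Rightarrow> real" where
  "walsh 0 i j = 1"
| "walsh (Suc k) i j = (if 2^k \<le> i \<and> 2^k \<le> j then -1 else 1) * walsh k (i mod 2^k) (j mod 2^k)"

lemma sum_lessThan_add: "(\<Sum>j<m + n. f j) = (\<Sum>j<m. f j) + (\<Sum>j<n. f (m + j :: nat) :: 'a::comm_monoid_add)"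
  by (induction n) (simp_all add: add.assoc)

lemma abs_walsh: "\<bar>walsh k i j\<bar> = 1"
  by (induction k i j rule: walsh.induct) (simp_all add: abs_mult)

lemma walsh_orthogonal:
  assumes "i < 2^k" "i' < 2^k"
  shows "(\<Sum>j<2^k. walsh k i j * walsh k i' j) = (if i = i' then 2^k else 0)"
  using assms
proof (induction k arbitrary: i i')
  case 0
  then show ?case by simp
next
  case (Suc k)
  define n where "n = (2::nat)^k"
  have n: "0 < n" by (simp add: n_def)
  let ?s = "\<lambda>i. if n \<le> i then - 1 else 1 :: real"
  have "(\<Sum>j<n. walsh (Suc k) i j * walsh (Suc k) i' j) = (\<Sum>j<n. walsh k (i mod n) j * walsh k (i' mod n) j)"
    by (rule sum.cong) (auto simp: n_def)
  moreover have "(\<Sum>j<n. walsh (Suc k) i (n + j) * walsh (Suc k) i' (n + j))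
      = (\<Sum>j<n. (?s i * ?s i') * (walsh k (i mod n) j * walsh k (i' mod n) j))"
    by (rule sum.cong) (auto simp: n_def)
  moreover have "(\<Sum>j<n. walsh k (i mod n) j * walsh k (i' mod n) j) = (if i mod n = i' mod n then 2^k else 0)"
    unfolding n_def by (rule Suc.IH) simp_all
  moreover have "{..<2^Suc k} = {..<n + n}" by (simp add: n_def mult_2)
  ultimately have eq: "(\<Sum>j<2^Suc k. walsh (Suc k) i j * walsh (Suc k) i' j)
      = (1 + ?s i * ?s i') * (if i mod n = i' mod n then 2^k else 0)"
    by (simp only: sum_lessThan_add sum_distrib_left[symmetric] distrib_right mult_1_left)
  have "i < 2 * n" "i' < 2 * n" using Suc.prems by (simp_all add: n_def)
  then have "i mod n = (if n \<le> i then i - n else i)" "i' mod n = (if n \<le> i' then i' - n else i')"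
    by (simp_all add: mod_if)
  then show ?case unfolding eq by auto
qed

text \<open>
  The block matrix \<open>(I, H / tau)\<close>.
\<close>

definition graph_matrix :: "nat \<Rightarrow> real \<Rightarrow> (nat \<Rightarrow> nat \<Rightarrow> real) \<Rightarrow> nat \<Rightarrow> nat \<Rightarrow> 'k::real_normed_field" where
  "graph_matrix n tau H i u = (if u < n then of_bool (u = i) else of_real (H i (u - n) / tau))"

text \<open>
  Let \<open>W\<close> have the blocks \<open>0\<close> and \<open>H\<close> in the first row and \<open>H\<^sup>T\<close> and \<open>0\<close> in the second.  Its entries are
  bounded by 1, and \<open>P W = tau P\<close>: large eigenvalues on a space of half the full dimension.  The
  trace \<open>T\<close> of \<open>C P W\<close> is at most the sum of the absolute values of the entries of \<open>C P\<close>, hence at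
  most \<open>2 * n * (mu - 1)\<close> by \<open>lift_cost\<close>.  On the other hand it equals \<open>tau\<close> times the trace of \<open>P C\<close>,
  and \<open>quot_cost\<close> forces \<open>P C\<close> to differ from the identity by at most \<open>mu / a\<close> on the diagonal.
\<close>

lemma graph_matrix_feasible_bound:
  fixes P :: "nat \<Rightarrow> nat \<Rightarrow> 'k::real_normed_field"
  assumes P: "P = graph_matrix n tau H" and n: "0 < n" and tau: "0 < tau" and a: "0 < a"
    and H_le: "\<And>i j. \<bar>H i j\<bar> \<le> 1"
    and H_orth: "\<And>i j. i < n \<Longrightarrow> j < n \<Longrightarrow> (\<Sum>v<n. H i v * H j v) = (if i = j then tau\<^sup>2 else 0)"
    and mu: "mu \<in> feasible a n (n + n) P"
  shows "tau * (1 - mu / a) \<le> 2 * (mu - 1)"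
proof -
  obtain C where C: "\<And>j. j < n + n \<Longrightarrow> lift_cost a n (n + n) P C j \<le> mu - 1"
      "\<And>i. i < n \<Longrightarrow> quot_cost a n (n + n) P C i \<le> mu" and mu1: "1 \<le> mu"
    using mu unfolding feasible_def by auto
  have P1: "P i u = of_bool (u = i)" if "u < n" for i u using that by (simp add: P graph_matrix_def)
  have P2: "P i (n + v) = of_real (H i v / tau)" for i v by (simp add: P graph_matrix_def)
  define S where "S j u = (\<Sum>i<n. C j i * P i u)" for j u
  define D where "D i k = (\<Sum>j<n + n. P i j * C j k)" for i k
  define W :: "nat \<Rightarrow> nat \<Rightarrow> 'k" where "W u j =
    (if u < n \<and> n \<le> j then of_real (H u (j - n)) else if n \<le> u \<and> j < n then of_real (H j (u - n)) else 0)" for u j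
  have W_le: "norm (W u j) \<le> 1" for u j using H_le by (simp add: W_def)
  have PW: "(\<Sum>u<n + n. P i u * W u j) = of_real tau * P i j" if i: "i < n" and j: "j < n + n" for i j
  proof (cases "j < n")
    case True
    have "(\<Sum>u<n + n. P i u * W u j) = of_real ((\<Sum>v<n. H i v * H j v) / tau)"
      using True by (simp add: sum_lessThan_add P2 W_def sum_divide_distrib)
    also have "\<dots> = of_real tau * P i j"
      using tau True i by (simp add: H_orth P1 power2_eq_square)
    finally show ?thesis .
  next
    case False
    then obtain v where v: "j = n + v" using le_Suc_ex not_less by blast
    have "(\<Sum>u<n + n. P i u * W u j) = (\<Sum>u<n. of_bool (u = i) * of_real (H u v))"
      using False by (simp add: sum_lessThan_add P1 W_def v)
    also have "\<dots> = of_real tau * P i j"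
      using i tau by (simp add: v P2 of_bool_def if_distrib[of "\<lambda>x. x * _"] cong: if_cong)
    finally show ?thesis .
  qed
  have S_le: "(\<Sum>u<n + n. norm (S j u)) \<le> mu - 1" if "j < n + n" for j
  proof -
    have "0 \<le> (\<Sum>i<n. norm (C j i)) / a" using a by (simp add: sum_nonneg)
    then show ?thesis using C(1)[OF that] unfolding lift_cost_def S_def by linarith
  qed
  define T where "T = (\<Sum>j<n + n. \<Sum>u<n + n. S j u * W u j)"
  have "norm T \<le> (\<Sum>j<n + n. mu - 1)"
    unfolding T_def
  proof (rule sum_norm_le)
    fix j assume j: "j \<in> {..<n + n}"
    have "norm (\<Sum>u<n + n. S j u * W u j) \<le> (\<Sum>u<n + n. norm (S j u)) * 1"
      by (rule norm_sum_mult_le[OF W_le])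
    then show "norm (\<Sum>u<n + n. S j u * W u j) \<le> mu - 1" using S_le[of j] j by simp
  qed
  then have T_le: "norm T \<le> real n * (2 * (mu - 1))" by (simp add: algebra_simps)
  have "T = (\<Sum>j<n + n. \<Sum>i<n. C j i * (of_real tau * P i j))"
    unfolding T_def
  proof (rule sum.cong)
    fix j assume j: "j \<in> {..<n + n}"
    have "(\<Sum>u<n + n. S j u * W u j) = (\<Sum>i<n. C j i * (\<Sum>u<n + n. P i u * W u j))"
      by (simp add: S_def sum_distrib_left sum_distrib_right mult.assoc) (rule sum.swap)
    also have "\<dots> = (\<Sum>i<n. C j i * (of_real tau * P i j))" using PW j by simp
    finally show "(\<Sum>u<n + n. S j u * W u j) = \<dots>" .
  qed simp
  also have "\<dots> = of_real tau * (\<Sum>i<n. D i i)"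
    unfolding D_def sum_distrib_left by (subst sum.swap) (simp add: mult_ac)
  finally have T_eq: "norm T = tau * norm (\<Sum>i<n. D i i)" using tau by (simp add: norm_mult)
  have D_le: "norm (1 - D i i) \<le> mu / a" if i: "i < n" for i
  proof -
    have "(\<Sum>k<n. D i k * P k i) = D i i"
      using i by (simp add: P1 of_bool_def if_distrib[of "\<lambda>x. _ * x"] cong: if_cong)
    then have "norm (1 - D i i) = norm (P i i - (\<Sum>k<n. D i k * P k i))" using i by (simp add: P1)
    also have "\<dots> \<le> (\<Sum>u<n + n. norm (P i u - (\<Sum>k<n. D i k * P k u)))"
      by (rule member_le_sum) (use i in auto)
    also have "\<dots> \<le> mu / a"
    proof -
      have "0 \<le> (\<Sum>k<n. norm (D i k))" by (simp add: sum_nonneg)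
      then have "a * (\<Sum>u<n + n. norm (P i u - (\<Sum>k<n. D i k * P k u))) \<le> mu"
        using C(2)[OF i] unfolding quot_cost_def D_def by linarith
      then show ?thesis using a by (simp add: field_simps)
    qed
    finally show ?thesis .
  qed
  have "norm (\<Sum>i<n. 1 - D i i) \<le> (\<Sum>i<n. mu / a)"
    by (rule sum_norm_le) (use D_le in auto)
  moreover have "(\<Sum>i<n. 1 - D i i) = of_nat n - (\<Sum>i<n. D i i)" by (simp add: sum_subtractf)
  moreover have "real n - norm (\<Sum>i<n. D i i) \<le> norm (of_nat n - (\<Sum>i<n. D i i))"
    using norm_triangle_ineq2[of "of_nat n :: 'k" "\<Sum>i<n. D i i"] by simp
  ultimately have "real n * (1 - mu / a) \<le> norm (\<Sum>i<n. D i i)" by (simp add: algebra_simps)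
  then have "tau * (real n * (1 - mu / a)) \<le> tau * norm (\<Sum>i<n. D i i)"
    using tau by (intro mult_left_mono) auto
  with T_le T_eq have "real n * (tau * (1 - mu / a)) \<le> real n * (2 * (mu - 1))"
    by (simp add: mult.left_commute)
  then show ?thesis using n by simp
qed

text \<open>
  For \<open>C = 0\<close> the only cost is \<open>a\<close> times a row sum of \<open>P\<close>, which is at most 1 for small \<open>a\<close>.
\<close>

lemma threshold_small:
  fixes P :: "nat \<Rightarrow> nat \<Rightarrow> 'k::real_normed_field"
  assumes b: "0 < b"
  obtains a where "0 < a" "a \<le> b" "threshold d N P a \<le> 1"
proof
  define s where "s = (\<Sum>i<d. \<Sum>u<N. norm (P i u))"
  define a where "a = min b (1 / (1 + s))"
  have s: "0 \<le> s" by (simp add: s_def sum_nonneg)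
  show a: "0 < a" "a \<le> b" using b s by (auto simp: a_def)
  have "quot_cost a d N P (\<lambda>_ _. 0) i \<le> 1" if "i < d" for i
  proof -
    have "(\<Sum>u<N. norm (P i u)) \<le> s"
      unfolding s_def by (rule member_le_sum) (use that in \<open>auto intro: sum_nonneg\<close>)
    then have "a * (\<Sum>u<N. norm (P i u)) \<le> 1 / (1 + s) * s"
      using s by (intro mult_mono) (auto simp: a_def sum_nonneg)
    also have "\<dots> \<le> 1" using s by simp
    finally show ?thesis by (simp add: quot_cost_def)
  qed
  then have "1 \<in> feasible a d N P"
    unfolding feasible_def by (auto simp: lift_cost_def intro!: exI[of _ "\<lambda>_ _. 0"])
  then show "threshold d N P a \<le> 1" by (rule threshold_le)
qed

lemma threshold_attains:
  fixes lam :: real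
  assumes lam: "1 < lam"
  obtains a d N and P R :: "nat \<Rightarrow> nat \<Rightarrow> 'k::real_normed_field"
  where "0 < a" "threshold d N P a = lam"
    "\<And>i k. i < d \<Longrightarrow> k < d \<Longrightarrow> (\<Sum>j<N. P i j * R j k) = of_bool (i = k)"
proof -
  obtain k where k: "(4 * lam)\<^sup>2 < 2 ^ k"
    using real_arch_pow[of 2 "(4 * lam)\<^sup>2"] by auto
  define n where "n = (2::nat)^k"
  define tau where "tau = sqrt (2^k)"
  have n: "0 < n" by (simp add: n_def)
  have tau2: "tau\<^sup>2 = 2^k" by (simp add: tau_def)
  have tau: "4 * lam < tau" unfolding tau_def using k by (rule real_less_rsqrt)
  define P :: "nat \<Rightarrow> nat \<Rightarrow> 'k" where "P = graph_matrix n tau (walsh k)"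
  \<comment> \<open>for \<open>mu < lam + 1\<close> this makes \<open>mu / b < 1 / 2\<close>, and then \<open>tau > 4 * lam\<close> contradicts the trace bound\<close>
  define b where "b = 2 * (lam + 1)"
  have b: "0 < b" using lam by (simp add: b_def)
  have "lam + 1 \<le> threshold n (n + n) P b"
  proof (rule le_threshold)
    fix mu assume mu: "mu \<in> feasible b n (n + n) P"
    have orth: "(\<Sum>v<n. walsh k i v * walsh k j v) = (if i = j then tau\<^sup>2 else 0)" if "i < n" "j < n" for i j
      using walsh_orthogonal[of i k j] that by (simp add: n_def tau2)
    have bound: "tau * (1 - mu / b) \<le> 2 * (mu - 1)"
      by (rule graph_matrix_feasible_bound[OF P_def n _ b _ orth mu]) (use tau lam abs_walsh in auto)
    show "lam + 1 \<le> mu"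
    proof (rule ccontr)
      assume "\<not> lam + 1 \<le> mu"
      then have "1 / 2 \<le> 1 - mu / b" using b by (simp add: b_def field_simps)
      then have "tau * (1 / 2) \<le> tau * (1 - mu / b)" using tau lam by (intro mult_left_mono) auto
      from order_trans[OF this bound] have "tau \<le> 4 * mu - 4" by simp
      then show False using tau \<open>\<not> lam + 1 \<le> mu\<close> by linarith
    qed
  qed
  then have hi: "lam \<le> threshold n (n + n) P b" by simp
  obtain c where c: "0 < c" "c \<le> b" "threshold n (n + n) P c \<le> 1"
    using threshold_small[OF b] by metis
  have "\<exists>a\<ge>c. a \<le> b \<and> threshold n (n + n) P a = lam"
  proof (rule IVT'[where f = "threshold n (n + n) P", OF _ hi c(2)])
    show "threshold n (n + n) P c \<le> lam" using c lam by simp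
    show "continuous_on {c..b} (threshold n (n + n) P)"
      by (rule continuous_on_subset[OF threshold_continuous]) (use c in auto)
  qed
  then obtain a where a: "c \<le> a" "threshold n (n + n) P a = lam" by blast
  have "(\<Sum>j<n + n. P i j * of_bool (j = m)) = of_bool (i = m)" if "i < n" "m < n" for i m
    using that by (auto simp: P_def graph_matrix_def of_bool_def if_distrib[of "\<lambda>x. _ * x"] cong: if_cong)
  with a c show ?thesis using that[of a n "n + n" P "\<lambda>j m. of_bool (j = m)"] by auto
qed

section \<open>Existence of the spaces\<close>

text \<open>
  The argument is the same for real and for complex scalars; the hypotheses are the instances of the
  Hahn--Banach theorem and of the independence of the test spaces, which are known for both fields.
\<close>

lemma plus_injective_not_injective_exists:
  fixes lam :: real
  assumes lam: "1 < lam"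
    and hb: "hahn_banach (linf :: ('k::{real_normed_field, euclidean_space}, nat \<Rightarrow> 'k) normed_module)"
    and hb_test: "\<And>Z :: ('k, (nat \<Rightarrow> 'k) \<Rightarrow> 'k) normed_module. normed_vector_space Z \<Longrightarrow> hahn_banach Z"
    and transfer_inj: "\<And>X :: ('k, nat \<Rightarrow> 'k) normed_module. banach_space X \<Longrightarrow> injective lam X \<Longrightarrow>
      injective_wrt TYPE(nat + nat \<Rightarrow> 'k) lam X"
  shows "\<exists>X :: ('k, nat \<Rightarrow> 'k) normed_module. banach_space X \<and> plus_injective lam X \<and> \<not> injective lam X"
proof -
  obtain theta :: "nat \<Rightarrow> (nat \<Rightarrow> 'k) \<Rightarrow> 'k" where "nonattaining_family theta"
    using nonattaining_family_exists[OF hb] by blast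
  then interpret nonattaining_family theta .
  obtain a d N and P R :: "nat \<Rightarrow> nat \<Rightarrow> 'k"
    where a: "0 < a" and thr: "threshold d N P a = lam"
      and R: "\<And>i k. i < d \<Longrightarrow> k < d \<Longrightarrow> (\<Sum>j<N. P i j * R j k) = of_bool (i = k)"
    using threshold_attains[OF lam] by blast
  interpret renorming theta a d N P by unfold_locales (rule a)
  have "plus_injective lam space"
    unfolding plus_injective_def
  proof (intro allI impI)
    fix \<epsilon> :: real assume "0 < \<epsilon>"
    then have "lam + \<epsilon> / 2 \<in> feasible a d N P"
      by (intro feasible_above_threshold) (simp add: thr)
    then show "injective (lam + \<epsilon>) space"
      unfolding injective_def using \<open>0 < \<epsilon>\<close> by (intro injective_above_feasible hb_test) auto
  qed
  moreover have "\<not> injective lam space"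
  proof
    assume "injective lam space"
    then obtain C where C: "\<And>j. j < N \<Longrightarrow> lift_cost a d N P C j < lam - 1"
        "\<And>i. i < d \<Longrightarrow> quot_cost a d N P C i \<le> lam"
      using injective_gives_matrix[OF transfer_inj[OF banach_space_space] lam] by blast
    have "threshold d N P a < lam"
      by (rule threshold_improves[OF a lam C R])
    then show False by (simp add: thr)
  qed
  ultimately show ?thesis using banach_space_space by blast
qed

theorem theoremA:
  fixes lam :: real
  assumes "lam > 1"
  shows "(\<exists>X :: (real, nat \<Rightarrow> real) normed_module.
            banach_space X \<and> plus_injective lam X \<and> \<not> injective lam X) \<and>
         (\<exists>X :: (complex, nat \<Rightarrow> complex) normed_module.
            banach_space X \<and> plus_injective lam X \<and> \<not> injective lam X)"
proof
  show "\<exists>X :: (real, nat \<Rightarrow> real) normed_module.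
      banach_space X \<and> plus_injective lam X \<and> \<not> injective lam X"
    by (rule plus_injective_not_injective_exists[OF assms hahn_banach_real[OF normed_vector_space_linf] hahn_banach_real])
       (use assms in \<open>auto intro: injective_imp_injective_wrt_real\<close>)
  show "\<exists>X :: (complex, nat \<Rightarrow> complex) normed_module.
      banach_space X \<and> plus_injective lam X \<and> \<not> injective lam X"
    by (rule plus_injective_not_injective_exists[OF assms hahn_banach_complex[OF normed_vector_space_linf] hahn_banach_complex])
       (use assms in \<open>auto intro: injective_imp_injective_wrt_complex\<close>)
qed

end
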